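(* Let $(G_t)_{t\in[0,T]}$ be a fractional Gaussian process with covariance function $R(s,t)=\mathbb{E}[G_tG_s]$ and associated fractional Brownian motion covariance $R^B$ with Hurst parameter $H\in(0,1)$, and let $\mathfrak{H}$, $\mathfrak{H}_1$ be the Hilbert spaces associated with $G$ and $B^H$ respectively. Let $f,g\in\mathcal{V}_{[0,T]}$. If, for each fixed $t\in[0,T]$, the function $g(\cdot)$ has no common discontinuity points on $[0,T]$ with the difference function $\frac{\partial R(\cdot,t)}{\partial t}-\frac{\partial R^{B}(\cdot,t)}{\partial t}$, then $$\langle f,g\rangle_{\mathfrak{H}}-\langle f,g\rangle_{\mathfrak{H}_1}=\int_{[0,T]^2} f(t)\,g(s)\,\mathrm{d}t\,\mu(t,\mathrm{d}s),$$ where, for each fixed $t\in[0,T]$, $\mu(t,\cdot)$ is the Lebesgue-Stieltjes measure of the normalized bounded variation function $s\mapsto\frac{\partial R(s,t)}{\partial t}-\frac{\partial R^{B}(s,t)}{\partial t}$ on $[0,T]$. In particular, if $g$ is continuous, then this identity holds.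
   Context: $T>0$ is fixed. $R^B(s,t)=\frac12\big(s^{2H}+t^{2H}-|t-s|^{2H}\big)$ is the covariance function of the fractional Brownian motion $(B^H_t)_{t\in[0,T]}$ with Hurst parameter $H\in(0,1)$. A function of bounded variation $F$ on $\mathbb{R}$ is called normalized if it is right continuous and $F(-\infty)=0$. A centred Gaussian process $(G_t)_{t\in[0,T]}$ with $G_0=0$ is called a fractional Gaussian process if its covariance $R(s,t)=\mathbb{E}[G_tG_s]$ satisfies: (1) for each fixed $s\in[0,T]$, $t\mapsto R(s,t)$ is absolutely continuous on $[0,T]$; (2) for each fixed $t\in[0,T]$, the difference $s\mapsto\frac{\partial R(s,t)}{\partial t}-\frac{\partial R^B(s,t)}{\partial t}$ is a normalized bounded variation function on $[0,T]$ (it is extended by $0$ on $(-\infty,0)$ and by its value at $s=T$ on $(T,\infty)$; it vanishes at $s=0$). The process $G$ and its covariance $R$ are assumed continuous. $\mathcal{V}_{[0,T]}$ is the set of bounded variation functions on $[0,T]$. The Hilbert space $\mathfrak{H}$ is the closure of the real step functions on $[0,T]$ under the inner product determined by $\langle \mathbf{1}_{[a,b]},\mathbf{1}_{[c,d]}\rangle_{\mathfrak{H}}=\mathbb{E}[(G_b-G_a)(G_d-G_c)]$; $\mathfrak{H}_1$ is the corresponding space for $B^H$. Functions in $\mathcal{V}_{[0,T]}$ are regarded as elements of $\mathfrak{H}$ (and similarly of $\mathfrak{H}_1$, with $R^B$ in place of $R$), and for $f,g\in\mathcal{V}_{[0,T]}$ one has $\langle f,g\rangle_{\mathfrak{H}}=\int_{[0,T]^2}R(s,t)\,\nu_f(\mathrm{d}t)\,\nu_g(\mathrm{d}s)$,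 where $\nu_g$ is the restriction to $[0,T]$ of the signed Lebesgue-Stieltjes measure on $\mathbb{R}$ of the function equal to $g$ on $[0,T]$ and to $0$ elsewhere.
   Formalization: It is assumed in addition that f(t)g(s) is absolutely integrable on [0,T]² against dt|μ|(t,ds), so that the right-hand integral exists; the difference of partial derivatives is any version equal to it for almost every t and normalized BV in s for every t. *)

theory Defs
  imports "HOL-Probability.Probability"
begin

section \<open>Functions of bounded variation and Lebesgue-Stieltjes integrals\<close>

definition variation_sums :: "(real \<Rightarrow> real) \<Rightarrow> real set \<Rightarrow> real set" where
  "variation_sums F A = {(\<Sum>i<n. \<bar>F (p (Suc i)) - F (p i)\<bar>) | (n::nat) (p::nat \<Rightarrow> real).
     (\<forall>i<n. p i \<le> p (Suc i)) \<and> (\<forall>i\<le>n. p i \<in> A)}"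

definition bounded_variation_on :: "(real \<Rightarrow> real) \<Rightarrow> real set \<Rightarrow> bool" where
  "bounded_variation_on F A \<longleftrightarrow> bdd_above (variation_sums F A)"

definition bv_functions :: "real \<Rightarrow> (real \<Rightarrow> real) set" where
  "bv_functions T = {f. bounded_variation_on f {0..T}}"

definition normalized_bv :: "(real \<Rightarrow> real) \<Rightarrow> bool" where
  "normalized_bv F \<longleftrightarrow> bounded_variation_on F UNIV \<and> (\<forall>x. continuous (at_right x) F)
     \<and> (F \<longlongrightarrow> 0) at_bot"

definition absolutely_continuous_fun_on :: "real \<Rightarrow> real \<Rightarrow> (real \<Rightarrow> real) \<Rightarrow> bool" where
  "absolutely_continuous_fun_on a b F \<longleftrightarrow>
     (\<forall>\<epsilon>>0. \<exists>\<delta>>0. \<forall>(n::nat) (u::nat \<Rightarrow> real) v.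
        (\<forall>i<n. a \<le> u i \<and> u i \<le> v i \<and> v i \<le> b)
        \<and> disjoint_family_on (\<lambda>i. {u i<..<v i}) {..<n}
        \<and> (\<Sum>i<n. v i - u i) < \<delta>
        \<longrightarrow> (\<Sum>i<n. \<bar>F (v i) - F (u i)\<bar>) < \<epsilon>)"

definition right_limit :: "(real \<Rightarrow> real) \<Rightarrow> real \<Rightarrow> real" where
  "right_limit F x = Lim (at_right x) F"

definition variation_upto :: "(real \<Rightarrow> real) \<Rightarrow> real \<Rightarrow> real" where
  "variation_upto F x = Sup (variation_sums F {..x})"

text \<open>
  The signed Lebesgue-Stieltjes measure of a function \<open>F\<close> of bounded variation on the real line
  gives \<open>{a<..b}\<close> the mass \<open>F(b+) - F(a+)\<close>. It is represented by its Jordan decomposition: with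
  \<open>V\<close> the variation function of the right-continuous version \<open>F\<^sup>+\<close> of \<open>F\<close>, the positive and negative
  parts are generated by \<open>(V + F\<^sup>+) / 2\<close> and \<open>(V - F\<^sup>+) / 2\<close>, and the total variation measure by \<open>V\<close>.
\<close>

definition ls_pos :: "(real \<Rightarrow> real) \<Rightarrow> real measure" where
  "ls_pos F = interval_measure
     (\<lambda>x. (variation_upto (right_limit F) x + right_limit F x) / 2)"

definition ls_neg :: "(real \<Rightarrow> real) \<Rightarrow> real measure" where
  "ls_neg F = interval_measure
     (\<lambda>x. (variation_upto (right_limit F) x - right_limit F x) / 2)"

definition ls_total :: "(real \<Rightarrow> real) \<Rightarrow> real measure" where
  "ls_total F = interval_measure (variation_upto (right_limit F))"

definition ls_integral :: "(real \<Rightarrow> real) \<Rightarrow> real set \<Rightarrow> (real \<Rightarrow> real) \<Rightarrow> real" where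
  "ls_integral F A \<phi> = (LINT x:A|ls_pos F. \<phi> x) - (LINT x:A|ls_neg F. \<phi> x)"

definition zero_extension :: "real \<Rightarrow> (real \<Rightarrow> real) \<Rightarrow> real \<Rightarrow> real" where
  "zero_extension T f x = (if x \<in> {0..T} then f x else 0)"

definition constant_extension :: "real \<Rightarrow> (real \<Rightarrow> real) \<Rightarrow> real \<Rightarrow> real" where
  "constant_extension T F x = (if x < 0 then 0 else F (min x T))"

text \<open>The integral over \<open>[0,T]\<close> of \<open>\<phi>\<close> against the measure \<open>\<nu>\<^sub>f\<close>.\<close>

definition nu_integral :: "real \<Rightarrow> (real \<Rightarrow> real) \<Rightarrow> (real \<Rightarrow> real) \<Rightarrow> real" where
  "nu_integral T f \<phi> = ls_integral (zero_extension T f) {0..T} \<phi>"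

text \<open>Discontinuity on \<open>[0,T]\<close> is that of the restriction to \<open>[0,T]\<close>, hence one-sided at the endpoints.\<close>

definition no_common_discontinuity :: "real \<Rightarrow> (real \<Rightarrow> real) \<Rightarrow> (real \<Rightarrow> real) \<Rightarrow> bool" where
  "no_common_discontinuity T g h \<longleftrightarrow>
     (\<forall>s\<in>{0..T}. continuous (at s within {0..T}) g \<or> continuous (at s within {0..T}) h)"


section \<open>Gaussian processes\<close>

text \<open>The zero variable is admitted as a degenerate normal variable.\<close>

definition centred_gaussian_process :: "'a measure \<Rightarrow> real \<Rightarrow> (real \<Rightarrow> 'a \<Rightarrow> real) \<Rightarrow> bool" where
  "centred_gaussian_process M T X \<longleftrightarrow> prob_space M \<and> (\<forall>t\<in>{0..T}. X t \<in> borel_measurable M) \<and>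
     (\<forall>J c. finite J \<and> J \<subseteq> {0..T} \<longrightarrow>
        (AE \<omega> in M. (\<Sum>t\<in>J. c t * X t \<omega>) = 0) \<or>
        (\<exists>\<sigma>>0. distributed M lborel (\<lambda>\<omega>. \<Sum>t\<in>J. c t * X t \<omega>) (\<lambda>x. ennreal (normal_density 0 \<sigma> x))))"

definition covariance_fun :: "'a measure \<Rightarrow> (real \<Rightarrow> 'a \<Rightarrow> real) \<Rightarrow> real \<Rightarrow> real \<Rightarrow> real" where
  "covariance_fun M X s t = (LINT \<omega>|M. X t \<omega> * X s \<omega>)"

definition fbm_cov :: "real \<Rightarrow> real \<Rightarrow> real \<Rightarrow> real" where
  "fbm_cov H s t = (s powr (2 * H) + t powr (2 * H) - \<bar>t - s\<bar> powr (2 * H)) / 2"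

definition fractional_brownian_motion ::
    "'a measure \<Rightarrow> real \<Rightarrow> real \<Rightarrow> (real \<Rightarrow> 'a \<Rightarrow> real) \<Rightarrow> bool" where
  "fractional_brownian_motion M T H B \<longleftrightarrow> centred_gaussian_process M T B \<and>
     (\<forall>s\<in>{0..T}. \<forall>t\<in>{0..T}. covariance_fun M B s t = fbm_cov H s t)"

text \<open>
  \<open>D s t\<close> stands for the difference of the partial derivatives in \<open>t\<close> of \<open>R(s,t)\<close> and \<open>R\<^sup>B(s,t)\<close>.
  For fixed \<open>s\<close>, absolute continuity provides these derivatives only for almost every \<open>t\<close> (for
  \<open>H \<le> 1/2\<close> the one of \<open>R\<^sup>B\<close> does not exist at \<open>t = s\<close>), so \<open>D\<close> is a version of the difference.
  By right continuity in \<open>s\<close>, two normalized versions agree in all \<open>s\<close> for almost every \<open>t\<close>.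
\<close>

definition partial_difference ::
    "real \<Rightarrow> (real \<Rightarrow> real \<Rightarrow> real) \<Rightarrow> (real \<Rightarrow> real \<Rightarrow> real) \<Rightarrow> (real \<Rightarrow> real \<Rightarrow> real) \<Rightarrow> bool" where
  "partial_difference T R R' D \<longleftrightarrow> (\<forall>s\<in>{0..T}. AE t in lebesgue. t \<in> {0..T} \<longrightarrow>
     (\<exists>r r'. ((\<lambda>u. R s u) has_real_derivative r) (at t within {0..T})
           \<and> ((\<lambda>u. R' s u) has_real_derivative r') (at t within {0..T})
           \<and> D s t = r - r'))"

definition fractional_gaussian_process ::
    "'a measure \<Rightarrow> real \<Rightarrow> real \<Rightarrow> (real \<Rightarrow> 'a \<Rightarrow> real) \<Rightarrow> (real \<Rightarrow> real \<Rightarrow> real) \<Rightarrow> bool" where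
  "fractional_gaussian_process M T H G D \<longleftrightarrow>
     centred_gaussian_process M T G
   \<and> (AE \<omega> in M. G 0 \<omega> = 0)
   \<and> (AE \<omega> in M. continuous_on {0..T} (\<lambda>t. G t \<omega>))
   \<and> continuous_on ({0..T} \<times> {0..T}) (\<lambda>(s, t). covariance_fun M G s t)
   \<and> (\<forall>s\<in>{0..T}. absolutely_continuous_fun_on 0 T (\<lambda>t. covariance_fun M G s t))
   \<and> partial_difference T (covariance_fun M G) (fbm_cov H) D
   \<and> (\<forall>t\<in>{0..T}. D 0 t = 0 \<and> normalized_bv (constant_extension T (\<lambda>s. D s t)))"

text \<open>Closed intervals include the degenerate ones \<open>{a..a}\<close>, so all real step functions are covered.\<close>

definition step_functions :: "real \<Rightarrow> (real \<Rightarrow> real) set" where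
  "step_functions T = {(\<lambda>x. \<Sum>i<n. c i * indicator {a i..b i} x) | (n::nat) (c::nat \<Rightarrow> real) a b.
     \<forall>i<n. 0 \<le> a i \<and> a i \<le> b i \<and> b i \<le> T}"

text \<open>
  The Hilbert space of a process \<open>X\<close> is a completion of the step functions, hence determined up to
  isometry; the type \<open>'h\<close> is any realisation of it. The map \<open>\<iota>\<close> is the identification of functions of
  bounded variation on \<open>[0,T]\<close> with elements of the space; its values on step functions being
  dense, the last clause determines \<open>\<iota> f\<close> for every such \<open>f\<close>.
\<close>

definition associated_hilbert_space :: "'a measure \<Rightarrow> real \<Rightarrow> (real \<Rightarrow> 'a \<Rightarrow> real)
    \<Rightarrow> ((real \<Rightarrow> real) \<Rightarrow> 'h::{real_inner, complete_space}) \<Rightarrow> bool" where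
  "associated_hilbert_space M T X \<iota> \<longleftrightarrow>
     (\<forall>f\<in>bv_functions T. \<forall>g\<in>bv_functions T. \<forall>c. \<iota> (\<lambda>x. c * f x + g x) = c *\<^sub>R \<iota> f + \<iota> g)
   \<and> (\<forall>a b c d. 0 \<le> a \<and> a \<le> b \<and> b \<le> T \<and> 0 \<le> c \<and> c \<le> d \<and> d \<le> T \<longrightarrow>
        inner (\<iota> (indicator {a..b})) (\<iota> (indicator {c..d}))
          = (LINT \<omega>|M. (X b \<omega> - X a \<omega>) * (X d \<omega> - X c \<omega>)))
   \<and> closure (\<iota> ` step_functions T) = UNIV
   \<and> (\<forall>f\<in>bv_functions T. \<forall>g\<in>bv_functions T.
        inner (\<iota> f) (\<iota> g)
          = nu_integral T g (\<lambda>s. nu_integral T f (\<lambda>t. covariance_fun M X s t)))"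

text \<open>
  \<open>dt_mu_integral T D f g\<close> is the integral of \<open>f(t) g(s)\<close> over \<open>[0,T]\<^sup>2\<close> against \<open>dt \<mu>(t,ds)\<close>, where
  \<open>\<mu>(t,\<cdot>)\<close> is the Lebesgue-Stieltjes measure of \<open>D(\<cdot>,t)\<close>. The integrand is absolutely integrable
  if its absolute value has a finite integral against \<open>dt |\<mu>|(t,ds)\<close>.
\<close>

definition dt_mu_integral ::
    "real \<Rightarrow> (real \<Rightarrow> real \<Rightarrow> real) \<Rightarrow> (real \<Rightarrow> real) \<Rightarrow> (real \<Rightarrow> real) \<Rightarrow> real" where
  "dt_mu_integral T D f g =
     (LINT t:{0..T}|lebesgue. f t * ls_integral (constant_extension T (\<lambda>s. D s t)) {0..T} g)"

definition dt_mu_integrable ::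
    "real \<Rightarrow> (real \<Rightarrow> real \<Rightarrow> real) \<Rightarrow> (real \<Rightarrow> real) \<Rightarrow> (real \<Rightarrow> real) \<Rightarrow> bool" where
  "dt_mu_integrable T D f g \<longleftrightarrow>
     (\<integral>\<^sup>+t\<in>{0..T}. (\<integral>\<^sup>+s\<in>{0..T}. ennreal \<bar>f t * g s\<bar>
        \<partial>ls_total (constant_extension T (\<lambda>s. D s t))) \<partial>lebesgue) < \<infinity>"

end

theory Submission
  imports Defs
begin

text \<open>
  Put \<open>K = R - R\<^sup>B\<close>, so that \<open>K(s,t) = \<integral> D(s,u) du\<close> over \<open>[0,t]\<close>. Since \<open>\<nu>\<^sub>f\<close> has total mass \<open>0\<close>, integration
  by parts turns the inner integral of \<open>K(s,\<cdot>)\<close> against \<open>\<nu>\<^sub>f\<close> into \<open>- \<psi>(s)\<close> with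
  \<open>\<psi>(s) = \<integral> f(u) D(s,u) du\<close>, a continuous function. By parts again, the integral of \<open>- \<psi>\<close> against
  \<open>\<nu>\<^sub>g\<close> is the limit of the Riemann sums of \<open>c\<^sub>i (\<psi>(s\<^sub>i\<^sub>+\<^sub>1) - \<psi>(s\<^sub>i))\<close> over uniform grids, for any values \<open>c\<^sub>i\<close>
  in the range of \<open>g\<close> on the cells. Each such sum is \<open>\<integral> f(u) (\<integral> g\<^sub>n d\<mu>(u,\<cdot>)) du\<close> for the step function
  \<open>g\<^sub>n\<close> with values \<open>c\<^sub>i\<close>, which involves only finite sums and no exchange of integrals.

  Fubini's theorem is not applicable to \<open>f(u) D(s,u)\<close> because only \<open>f(t) g(s)\<close> is known to be
  integrable. Therefore \<open>c\<^sub>i\<close> is the value of smallest modulus in the closed convex hull of the range of \<open>g\<close>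
  on the cell: then \<open>|g\<^sub>n| \<le> |g|\<close>, and \<open>g\<^sub>n \<rightarrow> g\<close> off the discontinuities of \<open>g\<close>, which carry no mass of
  \<open>\<mu>(u,\<cdot>)\<close>, so dominated convergence yields the limit.
\<close>

section \<open>Bounded variation\<close>

lemma variation_sumsI:
  fixes n :: nat and p :: "nat \<Rightarrow> real"
  assumes "\<And>i. i < n \<Longrightarrow> p i \<le> p (Suc i)" "\<And>i. i \<le> n \<Longrightarrow> p i \<in> A"
  shows "(\<Sum>i<n. \<bar>F (p (Suc i)) - F (p i)\<bar>) \<in> variation_sums F A"
  using assms unfolding variation_sums_def by blast

lemma variation_sumsE:
  assumes "S \<in> variation_sums F A"
  obtains n :: nat and p :: "nat \<Rightarrow> real"
  where "S = (\<Sum>i<n. \<bar>F (p (Suc i)) - F (p i)\<bar>)"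
    "\<And>i. i < n \<Longrightarrow> p i \<le> p (Suc i)" "\<And>i. i \<le> n \<Longrightarrow> p i \<in> A"
  using assms unfolding variation_sums_def by blast

lemma variation_sums_mono: "A \<subseteq> B \<Longrightarrow> variation_sums F A \<subseteq> variation_sums F B"
  unfolding variation_sums_def by blast

lemma zero_in_variation_sums: "x \<in> A \<Longrightarrow> 0 \<in> variation_sums F A"
  using variation_sumsI[of 0 "\<lambda>_. x" A F] by simp

lemma increment_in_variation_sums:
  "x \<le> y \<Longrightarrow> x \<in> A \<Longrightarrow> y \<in> A \<Longrightarrow> \<bar>F y - F x\<bar> \<in> variation_sums F A"
  using variation_sumsI[of 1 "\<lambda>i. if i = 0 then x else y" A F] by auto

text \<open>The two partitions are run through one after the other. The bridging increment, from the
  last point of the first to the first point of the second, is only known to be nonnegative, hence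
  the inequality; it also explains the \<open>Suc n + m\<close> cells.\<close>

lemma variation_sums_append:
  assumes "S \<in> variation_sums F A" "S' \<in> variation_sums F B"
    and le: "\<And>a b. a \<in> A \<Longrightarrow> b \<in> B \<Longrightarrow> a \<le> b"
  shows "\<exists>S''\<in>variation_sums F (A \<union> B). S + S' \<le> S''"
proof -
  obtain n p where p: "S = (\<Sum>i<n. \<bar>F (p (Suc i)) - F (p i)\<bar>)"
    "\<And>i. i < n \<Longrightarrow> p i \<le> p (Suc i)" "\<And>i. i \<le> n \<Longrightarrow> p i \<in> A"
    by (rule variation_sumsE[OF assms(1)]) blast
  obtain m q where q: "S' = (\<Sum>i<m. \<bar>F (q (Suc i)) - F (q i)\<bar>)"
    "\<And>i. i < m \<Longrightarrow> q i \<le> q (Suc i)" "\<And>i. i \<le> m \<Longrightarrow> q i \<in> B"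
    by (rule variation_sumsE[OF assms(2)]) blast
  define r where "r i = (if i \<le> n then p i else q (i - Suc n))" for i
  have "(\<Sum>i<Suc n + m. \<bar>F (r (Suc i)) - F (r i)\<bar>) \<in> variation_sums F (A \<union> B)"
  proof (rule variation_sumsI)
    fix i assume i: "i < Suc n + m"
    consider "i < n" | "i = n" | j where "i = Suc n + j"
      by (metis Suc_leI le_Suc_ex linorder_neqE_nat)
    then show "r i \<le> r (Suc i)"
    proof cases
      case 3 then show ?thesis using i q(2)[of j] by (simp add: r_def Suc_diff_le)
    next
      case 2 then show ?thesis using p(3)[of n] q(3)[of 0] le by (simp add: r_def)
    qed (use p in \<open>simp add: r_def\<close>)
  qed (use p q in \<open>auto simp: r_def\<close>)
  moreover have "S + S' \<le> (\<Sum>i<Suc n + m. \<bar>F (r (Suc i)) - F (r i)\<bar>)"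
  proof -
    have sum_add: "(\<Sum>i<k + m. h i) = (\<Sum>i<k. h i) + (\<Sum>i<m. h (k + i))" for k and h :: "nat \<Rightarrow> real"
      by (induction m) auto
    have "(\<Sum>i<Suc n + m. \<bar>F (r (Suc i)) - F (r i)\<bar>) =
      (\<Sum>i<n. \<bar>F (r (Suc i)) - F (r i)\<bar>) + \<bar>F (r (Suc n)) - F (r n)\<bar>
      + (\<Sum>i<m. \<bar>F (r (Suc (Suc n + i))) - F (r (Suc n + i))\<bar>)"
      by (simp only: sum_add sum.lessThan_Suc)
    also have "(\<Sum>i<n. \<bar>F (r (Suc i)) - F (r i)\<bar>) = S"
      unfolding p(1) by (rule sum.cong) (auto simp: r_def)
    also have "(\<Sum>i<m. \<bar>F (r (Suc (Suc n + i))) - F (r (Suc n + i))\<bar>) = S'"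
      unfolding q(1) by (rule sum.cong) (auto simp: r_def Suc_diff_le)
    finally show ?thesis by simp
  qed
  ultimately show ?thesis by blast
qed

text \<open>A cell with \<open>y\<close> inside is cut there by the triangle inequality; for any
  other cell one of the two truncated increments vanishes. In this way a partition is traded for one
  below \<open>y\<close> and one above \<open>y\<close>.\<close>

lemma sum_increments_split:
  fixes F :: "real \<Rightarrow> real" and p :: "nat \<Rightarrow> real"
  shows "(\<Sum>i<n. \<bar>F (p (Suc i)) - F (p i)\<bar>)
    \<le> (\<Sum>i<n. \<bar>F (min (p (Suc i)) y) - F (min (p i) y)\<bar>)
      + (\<Sum>i<n. \<bar>F (max (p (Suc i)) y) - F (max (p i) y)\<bar>)"
  unfolding sum.distrib[symmetric]
  by (rule sum_mono) (auto simp: min_def max_def)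

lemma variation_sums_min_max:
  fixes p :: "nat \<Rightarrow> real"
  assumes "\<And>i. i < n \<Longrightarrow> p i \<le> p (Suc i)"
  shows "(\<And>i. i \<le> n \<Longrightarrow> min (p i) y \<in> A) \<Longrightarrow>
      (\<Sum>i<n. \<bar>F (min (p (Suc i)) y) - F (min (p i) y)\<bar>) \<in> variation_sums F A"
    and "(\<And>i. i \<le> n \<Longrightarrow> max (p i) y \<in> A) \<Longrightarrow>
      (\<Sum>i<n. \<bar>F (max (p (Suc i)) y) - F (max (p i) y)\<bar>) \<in> variation_sums F A"
proof -
  have *: "min (p i) y \<le> min (p (Suc i)) y" "max (p i) y \<le> max (p (Suc i)) y" if "i < n" for i
    using assms[OF that] by auto
  show "(\<And>i. i \<le> n \<Longrightarrow> min (p i) y \<in> A) \<Longrightarrow>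
      (\<Sum>i<n. \<bar>F (min (p (Suc i)) y) - F (min (p i) y)\<bar>) \<in> variation_sums F A"
    by (rule variation_sumsI) (use * in auto)
  show "(\<And>i. i \<le> n \<Longrightarrow> max (p i) y \<in> A) \<Longrightarrow>
      (\<Sum>i<n. \<bar>F (max (p (Suc i)) y) - F (max (p i) y)\<bar>) \<in> variation_sums F A"
    by (rule variation_sumsI) (use * in auto)
qed

section \<open>Bounded variation expressed by a bounded monotone majorant\<close>

text \<open>The increments of \<open>v\<close> telescope along every partition. Together with the
  converse \<open>bounded_variation_onE\<close> this allows later arguments to avoid partitions
  altogether.\<close>

lemma bounded_variation_onI:
  assumes "\<And>x y. x \<in> A \<Longrightarrow> y \<in> A \<Longrightarrow> x \<le> y \<Longrightarrow> \<bar>F y - F x\<bar> \<le> v y - v x"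
    and "\<And>x y. x \<in> A \<Longrightarrow> y \<in> A \<Longrightarrow> v y - v x \<le> C"
  shows "bounded_variation_on F A"
  unfolding bounded_variation_on_def
proof (rule bdd_aboveI)
  fix S assume "S \<in> variation_sums F A"
  then obtain n p where p: "S = (\<Sum>i<n. \<bar>F (p (Suc i)) - F (p i)\<bar>)"
    "\<And>i. i < n \<Longrightarrow> p i \<le> p (Suc i)" "\<And>i. i \<le> n \<Longrightarrow> p i \<in> A"
    by (rule variation_sumsE) blast
  have "S \<le> (\<Sum>i<n. v (p (Suc i)) - v (p i))"
    unfolding p(1) by (intro sum_mono assms p) auto
  also have "\<dots> = v (p n) - v (p 0)" by (rule sum_lessThan_telescope)
  also have "\<dots> \<le> C" by (intro assms p) auto
  finally show "S \<le> C" .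
qed

text \<open>The majorant is the variation of \<open>F\<close> over the part of \<open>A\<close> up
  to \<open>x\<close>. Appending one more increment to a partition shows that it dominates the
  increments of \<open>F\<close>.\<close>

lemma bounded_variation_onE:
  assumes "bounded_variation_on F A"
  obtains v C where "mono v" "\<And>x. 0 \<le> v x" "\<And>x. v x \<le> C"
    "\<And>x y. x \<in> A \<Longrightarrow> y \<in> A \<Longrightarrow> x \<le> y \<Longrightarrow> \<bar>F y - F x\<bar> \<le> v y - v x"
proof -
  \<comment> \<open>The inserted \<open>0\<close> takes care of those \<open>x\<close> that lie
    below all of \<open>A\<close>, where there are no variation sums and the supremum would be one
    over the empty set.\<close>
  define v where "v x = Sup (insert 0 (variation_sums F (A \<inter> {..x})))" for x
  have bA: "bdd_above (variation_sums F A)"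
    using assms by (simp add: bounded_variation_on_def)
  have bdd: "bdd_above (insert 0 (variation_sums F (A \<inter> {..x})))" for x
    using bdd_above_mono[OF bA variation_sums_mono[of "A \<inter> {..x}" A F]] by simp
  show thesis
  proof (rule that[of v])
    show "mono v"
    proof (rule monoI)
      fix x y :: real assume "x \<le> y"
      then have "variation_sums F (A \<inter> {..x}) \<subseteq> variation_sums F (A \<inter> {..y})"
        by (intro variation_sums_mono) auto
      then show "v x \<le> v y" unfolding v_def by (intro cSup_subset_mono bdd) auto
    qed
    show "0 \<le> v x" for x unfolding v_def by (rule cSup_upper[OF _ bdd]) simp
    show "v x \<le> Sup (insert 0 (variation_sums F A))" for x
      unfolding v_def using variation_sums_mono[of "A \<inter> {..x}" A F] bA
      by (intro cSup_subset_mono) auto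
    fix x y assume xy: "x \<in> A" "y \<in> A" "x \<le> y"
    have "v x \<le> v y - \<bar>F y - F x\<bar>"
      unfolding v_def[of x]
    proof (rule cSup_least)
      fix S assume "S \<in> insert 0 (variation_sums F (A \<inter> {..x}))"
      then have "S \<in> variation_sums F (A \<inter> {..x})"
        using zero_in_variation_sums[of x "A \<inter> {..x}" F] xy by auto
      moreover have "\<bar>F y - F x\<bar> \<in> variation_sums F (A \<inter> {x..y})"
        using xy by (intro increment_in_variation_sums) auto
      ultimately obtain S'' where S'': "S'' \<in> variation_sums F (A \<inter> {..x} \<union> A \<inter> {x..y})"
        "S + \<bar>F y - F x\<bar> \<le> S''"
        using variation_sums_append[of S F "A \<inter> {..x}" _ "A \<inter> {x..y}"]
        by (meson IntD2 atLeastAtMost_iff atMost_iff order_trans)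
      have "S'' \<in> variation_sums F (A \<inter> {..y})"
        by (rule subsetD[OF variation_sums_mono S''(1)]) (use xy in auto)
      then have "S'' \<le> v y" unfolding v_def by (intro cSup_upper bdd) auto
      with S''(2) show "S \<le> v y - \<bar>F y - F x\<bar>" by simp
    qed simp
    then show "\<bar>F y - F x\<bar> \<le> v y - v x" by simp
  qed
qed

lemma bounded_variation_on_bounded:
  assumes "bounded_variation_on F A"
  obtains C where "0 \<le> C" "\<And>x. x \<in> A \<Longrightarrow> \<bar>F x\<bar> \<le> C"
proof (cases "A = {}")
  case False
  then obtain a where a: "a \<in> A" by blast
  obtain v C where v: "mono v" "\<And>x. 0 \<le> v x" "\<And>x. v x \<le> C"
    "\<And>x y. x \<in> A \<Longrightarrow> y \<in> A \<Longrightarrow> x \<le> y \<Longrightarrow> \<bar>F y - F x\<bar> \<le> v y - v x"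
    by (rule bounded_variation_onE[OF assms]) blast
  have "\<bar>F x\<bar> \<le> \<bar>F a\<bar> + C" if "x \<in> A" for x
    using v(4)[OF that a] v(4)[OF a that] v(2)[of x] v(2)[of a] v(3)[of x] v(3)[of a]
    by (cases "x \<le> a") linarith+
  then show thesis using that[of "\<bar>F a\<bar> + C"] v(2)[of a] v(3)[of a] by auto
qed (use that[of 0] in auto)

section \<open>The total variation function and its one-sided continuity\<close>

context
  fixes F :: "real \<Rightarrow> real"
  assumes bv: "bounded_variation_on F UNIV"
begin

lemma bdd_above_variation_sums: "bdd_above (variation_sums F A)"
  using bv by (meson bdd_above_mono bounded_variation_on_def subset_UNIV variation_sums_mono)

lemma variation_upto_upper: "S \<in> variation_sums F {..x} \<Longrightarrow> S \<le> variation_upto F x"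
  unfolding variation_upto_def by (intro cSup_upper bdd_above_variation_sums)

lemma variation_upto_add:
  assumes "x \<le> y" "S \<in> variation_sums F {x..y}"
  shows "variation_upto F x + S \<le> variation_upto F y"
proof -
  have "variation_upto F x \<le> variation_upto F y - S"
    unfolding variation_upto_def[of _ x]
  proof (rule cSup_least)
    fix S' assume S': "S' \<in> variation_sums F {..x}"
    obtain S'' where S'': "S'' \<in> variation_sums F ({..x} \<union> {x..y})" "S' + S \<le> S''"
      using variation_sums_append[OF S' assms(2)] by auto
    moreover have "{..x} \<union> {x..y} = {..y}" using assms by auto
    ultimately show "S' \<le> variation_upto F y - S"
      using variation_upto_upper[of S'' y] by auto
  qed (use zero_in_variation_sums[of x "{..x}"] in auto)
  then show ?thesis by simp
qed

lemma variation_upto_increment: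
  "x \<le> y \<Longrightarrow> \<bar>F y - F x\<bar> \<le> variation_upto F y - variation_upto F x"
  using variation_upto_add[OF _ increment_in_variation_sums[of x y "{x..y}" F]] by force

lemma variation_upto_mono: "x \<le> y \<Longrightarrow> variation_upto F x \<le> variation_upto F y"
  using variation_upto_increment[of x y] by linarith

text \<open>A partition that nearly exhausts the variation up to \<open>y\<close> is cut at
  \<open>x\<close>. Its lower part uses up at most \<open>variation_upto F x\<close>, so the upper
  part must carry the rest, up to \<open>e\<close>.\<close>

lemma variation_upto_approx:
  assumes "x \<le> y" "0 < e"
  obtains n :: nat and p :: "nat \<Rightarrow> real"
  where "variation_upto F y - variation_upto F x - e < (\<Sum>i<n. \<bar>F (p (Suc i)) - F (p i)\<bar>)"
    "\<And>i. i < n \<Longrightarrow> p i \<le> p (Suc i)" "\<And>i. i \<le> n \<Longrightarrow> p i \<in> {x..y}"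
proof -
  have "variation_upto F y - e < Sup (variation_sums F {..y})"
    using assms by (simp add: variation_upto_def)
  then obtain S where S: "S \<in> variation_sums F {..y}" "variation_upto F y - e < S"
    using less_cSupE[of _ "variation_sums F {..y}"] zero_in_variation_sums[of y "{..y}" F] by auto
  obtain n p where p: "S = (\<Sum>i<n. \<bar>F (p (Suc i)) - F (p i)\<bar>)"
    "\<And>i. i < n \<Longrightarrow> p i \<le> p (Suc i)" "\<And>i. i \<le> n \<Longrightarrow> p i \<in> {..y}"
    by (rule variation_sumsE[OF S(1)]) blast
  have "(\<Sum>i<n. \<bar>F (min (p (Suc i)) x) - F (min (p i) x)\<bar>) \<le> variation_upto F x"
    by (intro variation_upto_upper variation_sums_min_max p) auto
  then have *: "variation_upto F y - variation_upto F x - e <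
      (\<Sum>i<n. \<bar>F (max (p (Suc i)) x) - F (max (p i) x)\<bar>)"
    using sum_increments_split[of F p n x] S(2) unfolding p(1) by linarith
  show thesis
  proof (rule that[OF *])
    show "max (p i) x \<le> max (p (Suc i)) x" if "i < n" for i using p(2)[OF that] by auto
    show "max (p i) x \<in> {x..y}" if "i \<le> n" for i using p(3)[OF that] assms by auto
  qed
qed

text \<open>One finite partition of \<open>{x..x+1}\<close> captures the variation there up to
  \<open>e / 2\<close>, and it is cut at a variable point \<open>y\<close>. The part above
  \<open>y\<close> is charged to the variation over \<open>{y..x+1}\<close>. The part below
  \<open>y\<close> is \<open>h y\<close>, which tends to \<open>0\<close> because its finitely many
  points are squeezed into \<open>{x..y}\<close>.\<close>

lemma variation_upto_continuous_at_right:
  assumes cont: "continuous (at_right x) F"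
  shows "continuous (at_right x) (variation_upto F)"
  unfolding continuous_within
proof (rule tendstoI)
  fix e :: real assume "0 < e"
  obtain n p where p: "variation_upto F (x + 1) - variation_upto F x - e / 2
        < (\<Sum>i<n. \<bar>F (p (Suc i)) - F (p i)\<bar>)"
    "\<And>i. i < n \<Longrightarrow> p i \<le> p (Suc i)" "\<And>i. i \<le> n \<Longrightarrow> p i \<in> {x..x+1}"
    by (rule variation_upto_approx[of x "x+1" "e/2"]) (use \<open>0 < e\<close> in auto)
  define h where "h y = (\<Sum>i<n. \<bar>F (min (p (Suc i)) y) - F (min (p i) y)\<bar>)" for y
  \<comment> \<open>Once \<open>y\<close> is close to \<open>x\<close>, truncation moves every
    partition point other than \<open>x\<close> to \<open>y\<close> itself, so only the values
    \<open>F x\<close> and \<open>F y\<close> are left.\<close>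
  have lim: "((\<lambda>y. F (min (p i) y)) \<longlongrightarrow> F x) (at_right x)" if "i \<le> n" for i
  proof (cases "p i = x")
    case True
    then have "eventually (\<lambda>y. F (min (p i) y) = F x) (at_right x)"
      using eventually_at_right_less[of x] by (auto elim!: eventually_mono simp: min_def)
    then show ?thesis by (rule tendsto_eventually)
  next
    case False
    then have "x < p i" using p(3)[OF that] by auto
    then have "eventually (\<lambda>y. F (min (p i) y) = F y) (at_right x)"
      unfolding eventually_at_right[OF \<open>x < p i\<close>] by (intro exI[of _ "p i"]) (auto simp: min_def)
    moreover have "(F \<longlongrightarrow> F x) (at_right x)" using cont by (simp add: continuous_within)
    ultimately show ?thesis by (simp add: tendsto_cong)
  qed
  have "(h \<longlongrightarrow> (\<Sum>i<n. \<bar>F x - F x\<bar>)) (at_right x)"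
    unfolding h_def by (intro tendsto_intros lim) auto
  then have "eventually (\<lambda>y. h y < e / 2) (at_right x)"
    using \<open>0 < e\<close> by (intro order_tendstoD(2)) auto
  moreover have "eventually (\<lambda>y. y \<in> {x<..<x+1}) (at_right x)"
    by (rule eventually_at_right_real) simp
  ultimately show "eventually (\<lambda>y. dist (variation_upto F y) (variation_upto F x) < e) (at_right x)"
  proof eventually_elim
    case (elim y)
    have "(\<Sum>i<n. \<bar>F (max (p (Suc i)) y) - F (max (p i) y)\<bar>) \<in> variation_sums F {y..x+1}"
      using elim p by (intro variation_sums_min_max) auto
    then have "variation_upto F y + (\<Sum>i<n. \<bar>F (max (p (Suc i)) y) - F (max (p i) y)\<bar>)
        \<le> variation_upto F (x + 1)"
      using elim by (intro variation_upto_add) auto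
    moreover have "variation_upto F x \<le> variation_upto F y"
      using elim by (intro variation_upto_mono) auto
    ultimately show ?case
      using p(1) sum_increments_split[of F p n y] elim(1) unfolding h_def dist_real_def by linarith
  qed
qed

text \<open>The mirror image: the partition of \<open>{x-1..x}\<close> is cut at
  \<open>y < x\<close>, and now the part above \<open>y\<close> shrinks. The result is used to show
  that points of continuity carry no mass of either part of the measure.\<close>

lemma variation_upto_continuous_at_left:
  assumes cont: "continuous (at_left x) F"
  shows "continuous (at_left x) (variation_upto F)"
  unfolding continuous_within
proof (rule tendstoI)
  fix e :: real assume "0 < e"
  obtain n p where p: "variation_upto F x - variation_upto F (x - 1) - e / 2
        < (\<Sum>i<n. \<bar>F (p (Suc i)) - F (p i)\<bar>)"
    "\<And>i. i < n \<Longrightarrow> p i \<le> p (Suc i)" "\<And>i. i \<le> n \<Longrightarrow> p i \<in> {x-1..x}"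
    by (rule variation_upto_approx[of "x-1" "x" "e/2"]) (use \<open>0 < e\<close> in auto)
  define h where "h y = (\<Sum>i<n. \<bar>F (max (p (Suc i)) y) - F (max (p i) y)\<bar>)" for y
  have lim: "((\<lambda>y. F (max (p i) y)) \<longlongrightarrow> F x) (at_left x)" if "i \<le> n" for i
  proof (cases "p i = x")
    case True
    have "eventually (\<lambda>y. y < x) (at_left x)" by (simp add: eventually_at_filter)
    then have "eventually (\<lambda>y. F (max (p i) y) = F x) (at_left x)"
      by eventually_elim (use True in \<open>auto simp: max_def\<close>)
    then show ?thesis by (rule tendsto_eventually)
  next
    case False
    then have "p i < x" using p(3)[OF that] by auto
    then have "eventually (\<lambda>y. F (max (p i) y) = F y) (at_left x)"
      unfolding eventually_at_left[OF \<open>p i < x\<close>] by (intro exI[of _ "p i"]) (auto simp: max_def)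
    moreover have "(F \<longlongrightarrow> F x) (at_left x)" using cont by (simp add: continuous_within)
    ultimately show ?thesis by (simp add: tendsto_cong)
  qed
  have "(h \<longlongrightarrow> (\<Sum>i<n. \<bar>F x - F x\<bar>)) (at_left x)"
    unfolding h_def by (intro tendsto_intros lim) auto
  then have "eventually (\<lambda>y. h y < e / 2) (at_left x)"
    using \<open>0 < e\<close> by (intro order_tendstoD(2)) auto
  moreover have "eventually (\<lambda>y. y \<in> {x-1<..<x}) (at_left x)"
    by (rule eventually_at_left_real) simp
  ultimately show "eventually (\<lambda>y. dist (variation_upto F y) (variation_upto F x) < e) (at_left x)"
  proof eventually_elim
    case (elim y)
    have "(\<Sum>i<n. \<bar>F (min (p (Suc i)) y) - F (min (p i) y)\<bar>) \<in> variation_sums F {x-1..y}"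
      using elim p by (intro variation_sums_min_max) auto
    then have "variation_upto F (x - 1) + (\<Sum>i<n. \<bar>F (min (p (Suc i)) y) - F (min (p i) y)\<bar>)
        \<le> variation_upto F y"
      using elim by (intro variation_upto_add) auto
    moreover have "variation_upto F y \<le> variation_upto F x"
      using elim by (intro variation_upto_mono) auto
    ultimately show ?case
      using p(1) sum_increments_split[of F p n y] elim(1) unfolding h_def dist_real_def by linarith
  qed
qed

end

section \<open>Right limits of functions of bounded variation\<close>

lemma mono_bounded_tendsto_at_right:
  fixes v :: "real \<Rightarrow> real"
  assumes "mono v" "\<And>x. C \<le> v x"
  shows "(v \<longlongrightarrow> Inf (v ` {x<..})) (at_right x)"
  using Lim_right_bound[of UNIV x v C] assms by (auto simp: mono_def)

text \<open>\<open>F\<close> is the difference of the monotone functions \<open>v + F\<close> and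
  \<open>v\<close>, both bounded below, and these have right limits.\<close>

lemma bounded_variation_right_limit:
  assumes "bounded_variation_on F UNIV"
  shows "(F \<longlongrightarrow> right_limit F x) (at_right x)"
proof -
  obtain v C where v: "mono v" "\<And>x. 0 \<le> v x" "\<And>x. v x \<le> C"
    "\<And>x y. x \<le> y \<Longrightarrow> \<bar>F y - F x\<bar> \<le> v y - v x"
    by (rule bounded_variation_onE[OF assms]) blast
  obtain K where K: "\<And>x. \<bar>F x\<bar> \<le> K"
    using bounded_variation_on_bounded[OF assms] by auto
  have "mono (\<lambda>y. v y + F y)" by (rule monoI) (use v(4) in \<open>smt (verit)\<close>)
  moreover have "- K \<le> v y + F y" for y using v(2)[of y] K[of y] by linarith
  ultimately have "((\<lambda>y. v y + F y) \<longlongrightarrow> Inf ((\<lambda>y. v y + F y) ` {x<..})) (at_right x)"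
    by (rule mono_bounded_tendsto_at_right)
  from tendsto_diff[OF this mono_bounded_tendsto_at_right[OF v(1,2)]]
  have "(F \<longlongrightarrow> Inf ((\<lambda>y. v y + F y) ` {x<..}) - Inf (v ` {x<..})) (at_right x)" by simp
  then show ?thesis
    unfolding right_limit_def by (metis tendsto_Lim trivial_limit_at_right_real)
qed

lemma bounded_variation_right_limit_bv:
  assumes "bounded_variation_on F UNIV"
  shows "bounded_variation_on (right_limit F) UNIV"
proof -
  obtain v C where v: "mono v" "\<And>x. 0 \<le> v x" "\<And>x. v x \<le> C"
    "\<And>x y. x \<le> y \<Longrightarrow> \<bar>F y - F x\<bar> \<le> v y - v x"
    by (rule bounded_variation_onE[OF assms]) blast
  define w where "w x = Inf (v ` {x<..})" for x
  have w: "(v \<longlongrightarrow> w x) (at_right x)" for x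
    unfolding w_def using mono_bounded_tendsto_at_right[OF v(1,2)] .
  \<comment> \<open>Right limits at \<open>x\<close> and at \<open>y\<close> belong to different
    filters. After the shift both are limits for the same \<open>h\<close> tending to
    \<open>0\<close> from the right, so an inequality between increments passes to the
    limit.\<close>
  have shift: "((\<lambda>h. f (x + h)) \<longlongrightarrow> l) (at_right 0)" if "(f \<longlongrightarrow> l) (at_right x)"
    for f :: "real \<Rightarrow> real" and l x
    using that by (subst (asm) filterlim_at_right_to_0) (simp add: add.commute)
  show ?thesis
  proof (rule bounded_variation_onI)
    fix x y :: real assume "x \<le> y"
    then show "\<bar>right_limit F y - right_limit F x\<bar> \<le> w y - w x"
      by (intro tendsto_le[OF trivial_limit_at_right_real
            tendsto_diff[OF shift[OF w[of y]] shift[OF w[of x]]]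
            tendsto_rabs[OF tendsto_diff[OF shift[OF bounded_variation_right_limit[OF assms, of y]]
                shift[OF bounded_variation_right_limit[OF assms, of x]]]]] always_eventually allI v) auto
  next
    have "0 \<le> w x" "w x \<le> C" for x
      by (auto intro!: tendsto_lowerbound[OF w] tendsto_upperbound[OF w] always_eventually v)
    then show "w y - w x \<le> C" for x y by (smt (verit))
  qed
qed

lemma right_limit_continuous:
  assumes "bounded_variation_on F UNIV"
  shows "continuous (at_right x) (right_limit F)"
  unfolding continuous_within
proof (rule tendstoI)
  note lim = bounded_variation_right_limit[OF assms]
  fix e :: real assume "0 < e"
  then have "eventually (\<lambda>y. dist (F y) (right_limit F x) < e / 2) (at_right x)"
    by (intro tendstoD[OF lim]) auto
  then obtain b where b: "x < b" "\<And>y. x < y \<Longrightarrow> y < b \<Longrightarrow> dist (F y) (right_limit F x) < e / 2"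
    using eventually_at_right_field[of _ x] by auto
  have "dist (right_limit F y) (right_limit F x) < e" if "x < y" "y < b" for y
  proof -
    have "eventually (\<lambda>z. dist (F z) (right_limit F x) \<le> e / 2) (at_right y)"
      unfolding eventually_at_right[OF that(2)]
      using b(2) that by (intro exI[of _ b]) (auto intro: less_imp_le)
    then have "dist (right_limit F y) (right_limit F x) \<le> e / 2"
      by (intro tendsto_upperbound[OF tendsto_dist[OF lim tendsto_const]]) auto
    then show ?thesis using \<open>0 < e\<close> by simp
  qed
  then show "eventually (\<lambda>y. dist (right_limit F y) (right_limit F x) < e) (at_right x)"
    unfolding eventually_at_right_field using b(1) by blast
qed

lemma right_limit_eq: "continuous (at_right x) F \<Longrightarrow> right_limit F x = F x"
  unfolding right_limit_def continuous_within
  by (rule tendsto_Lim[OF trivial_limit_at_right_real])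

section \<open>Lebesgue-Stieltjes integrals of grid step functions\<close>

text \<open>The index may exceed \<open>n\<close>: points beyond \<open>T\<close> occur when a right
  limit at the end of the last cell is estimated. For \<open>n = 0\<close> all points are
  \<open>0\<close>.\<close>

definition grid :: "real \<Rightarrow> nat \<Rightarrow> nat \<Rightarrow> real" where
  "grid T n i = real i * T / real n"

text \<open>The cells are open on the left, to match the half-open intervals measured by
  \<open>interval_measure\<close>. The value at \<open>0\<close> is therefore \<open>0\<close>; in
  each later approximation either the limit function vanishes at \<open>0\<close> or the point
  \<open>0\<close> carries no mass.\<close>

definition grid_step :: "real \<Rightarrow> nat \<Rightarrow> (nat \<Rightarrow> real) \<Rightarrow> real \<Rightarrow> real" where
  "grid_step T n c x = (\<Sum>i<n. c i * indicator {grid T n i<..grid T n (Suc i)} x)"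

lemma grid_0 [simp]: "grid T n 0 = 0"
  by (simp add: grid_def)

lemma grid_self [simp]: "0 < n \<Longrightarrow> grid T n n = T"
  by (simp add: grid_def)

lemma grid_mono: "0 < T \<Longrightarrow> i \<le> j \<Longrightarrow> grid T n i \<le> grid T n j"
  by (simp add: grid_def divide_right_mono)

lemma grid_less_Suc: "0 < T \<Longrightarrow> 0 < n \<Longrightarrow> grid T n i < grid T n (Suc i)"
  by (simp add: grid_def divide_strict_right_mono)

lemma grid_Suc: "grid T n (Suc i) = grid T n i + T / real n"
  by (simp add: grid_def add_divide_distrib distrib_right)

lemma grid_mem: "0 < T \<Longrightarrow> i \<le> n \<Longrightarrow> grid T n i \<in> {0..T}"
  by (cases "n = 0") (auto simp: grid_def divide_le_eq mult_right_mono)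

lemma grid_cell_subset: "0 < T \<Longrightarrow> i < n \<Longrightarrow> {grid T n i..grid T n (Suc i)} \<subseteq> {0..T}"
  using grid_mem[of T i n] grid_mem[of T "Suc i" n] by auto

lemma grid_cellE:
  assumes "0 < T" "0 < n" "x \<in> {0<..T}"
  obtains i where "i < n" "x \<in> {grid T n i<..grid T n (Suc i)}"
proof -
  define k where "k = (LEAST i. x \<le> grid T n i)"
  have n: "x \<le> grid T n n" using assms by simp
  have k: "x \<le> grid T n k" unfolding k_def using n by (rule LeastI)
  have "k \<le> n" unfolding k_def using n by (rule Least_le)
  have "k \<noteq> 0" using k assms by (cases k) auto
  then obtain i where i: "k = Suc i" using not0_implies_Suc by blast
  have "\<not> x \<le> grid T n i" using not_less_Least[of i "\<lambda>i. x \<le> grid T n i"] i k_def by simp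
  then show thesis using that[of i] i k \<open>k \<le> n\<close> by auto
qed

lemma grid_step_eq:
  assumes "0 < T" "i < n" "x \<in> {grid T n i<..grid T n (Suc i)}"
  shows "grid_step T n c x = c i"
proof -
  have "c j * indicator {grid T n j<..grid T n (Suc j)} x = (if j = i then c i else 0)" for j
  proof -
    consider "j = i" | "Suc j \<le> i" | "Suc i \<le> j" by linarith
    then show ?thesis
      using assms grid_mono[of T "Suc j" i n] grid_mono[of T "Suc i" j n]
      by cases (auto simp: indicator_def)
  qed
  then show ?thesis unfolding grid_step_def using assms by simp
qed

lemma grid_step_outside:
  assumes "0 < T" "x \<notin> {0<..T}"
  shows "grid_step T n c x = 0"
  unfolding grid_step_def
proof (rule sum.neutral, intro ballI)
  fix i assume "i \<in> {..<n}"
  then have "x \<notin> {grid T n i<..grid T n (Suc i)}"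
    using grid_mem[of T i n] grid_mem[of T "Suc i" n] assms by auto
  then show "c i * indicator {grid T n i<..grid T n (Suc i)} x = 0" by simp
qed

lemma grid_step_measurable [measurable]: "grid_step T n c \<in> borel_measurable borel"
  unfolding grid_step_def by measurable

text \<open>The only demand on \<open>c n i\<close> is that it inherits every bound for the distance
  of \<open>h\<close> from \<open>h x\<close> over the cell. This covers the value at the left end,
  for which the cell has to be closed, as well as the values of smallest modulus. The cells
  containing \<open>x\<close> shrink to \<open>x\<close>, so continuity at \<open>x\<close>
  suffices.\<close>

lemma grid_step_tendsto:
  assumes T: "0 < T" and x: "x \<in> {0<..T}" and cont: "continuous (at x within {0..T}) h"
    and c: "\<And>n i e. i < n \<Longrightarrow>
      (\<And>y. y \<in> {grid T n i..grid T n (Suc i)} \<Longrightarrow> \<bar>h y - h x\<bar> \<le> e) \<Longrightarrow> \<bar>c n i - h x\<bar> \<le> e"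
  shows "(\<lambda>n. grid_step T n (c n) x) \<longlonglongrightarrow> h x"
proof (rule LIMSEQ_I)
  fix e :: real assume "0 < e"
  then obtain d where d: "0 < d" "\<And>y. y \<in> {0..T} \<Longrightarrow> dist y x < d \<Longrightarrow> dist (h y) (h x) < e / 2"
    using cont[unfolded continuous_within_eps_delta, rule_format, of "e / 2"] by auto
  obtain k :: nat where k: "T / d < real k" using reals_Archimedean2 by blast
  show "\<exists>no. \<forall>n\<ge>no. norm (grid_step T n (c n) x - h x) < e"
  proof (intro exI allI impI)
    \<comment> \<open>The bound \<open>k\<close> makes the mesh smaller than \<open>d\<close>, and
      the \<open>1\<close> excludes the grid without cells.\<close>
    fix n assume "max k 1 \<le> n"
    then have n: "0 < n" "T / d < real n" using k by auto
    then have n_d: "T / real n < d" using d(1) by (simp add: field_simps)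
    obtain i where i: "i < n" "x \<in> {grid T n i<..grid T n (Suc i)}"
      by (rule grid_cellE[OF T n(1) x])
    have "\<bar>c n i - h x\<bar> \<le> e / 2"
    proof (rule c[OF i(1)])
      fix y assume y: "y \<in> {grid T n i..grid T n (Suc i)}"
      then have "dist y x < d" using i(2) n_d grid_Suc[of T n i] unfolding dist_real_def by auto
      moreover have "y \<in> {0..T}" using y grid_cell_subset[OF T i(1)] by blast
      ultimately show "\<bar>h y - h x\<bar> \<le> e / 2"
        using d(2)[of y] by (simp add: dist_real_def)
    qed
    then show "norm (grid_step T n (c n) x - h x) < e"
      using \<open>0 < e\<close> by (simp add: grid_step_eq[OF T i])
  qed
qed

section \<open>Grid steps and bounded convergence for \<open>interval_measure\<close>\<close>

text \<open>For every \<open>y < x\<close> the point is contained in \<open>{y<..x}\<close>, whose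
  mass \<open>W x - W y\<close> tends to \<open>0\<close>.\<close>

lemma interval_measure_singleton:
  assumes mono: "\<And>x y. x \<le> y \<Longrightarrow> W x \<le> W y" and right: "\<And>x. continuous (at_right x) W"
    and left: "continuous (at_left x) W"
  shows "emeasure (interval_measure W) {x} = 0"
proof (rule antisym)
  have "emeasure (interval_measure W) {x} \<le> ennreal (W x - W y)" if "y < x" for y
    using emeasure_mono[of "{x}" "{y<..x}" "interval_measure W"]
      emeasure_interval_measure_Ioc[OF less_imp_le[OF that] mono right] that by auto
  then have "eventually (\<lambda>y. emeasure (interval_measure W) {x} \<le> ennreal (W x - W y)) (at_left x)"
    by (auto simp: eventually_at_filter)
  moreover have "((\<lambda>y. ennreal (W x - W y)) \<longlongrightarrow> ennreal (W x - W x)) (at_left x)"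
    using left by (intro tendsto_intros) (simp add: continuous_within)
  ultimately show "emeasure (interval_measure W) {x} \<le> 0"
    by (intro tendsto_lowerbound[of "\<lambda>y. ennreal (W x - W y)"]) auto
qed simp

lemma interval_measure_Icc_finite:
  assumes "\<And>x y. x \<le> y \<Longrightarrow> W x \<le> W y" "\<And>x. continuous (at_right x) W"
  shows "emeasure (interval_measure W) {a..b} < \<infinity>"
proof (cases "a \<le> b")
  case True
  have "emeasure (interval_measure W) {a..b} \<le> emeasure (interval_measure W) {a-1<..b}"
    by (intro emeasure_mono) auto
  also have "\<dots> < \<infinity>"
    using True emeasure_interval_measure_Ioc[of "a-1" b W] assms by simp
  finally show ?thesis .
qed simp

lemma set_integral_grid_step:
  assumes T: "0 < T" and mono: "\<And>x y. x \<le> y \<Longrightarrow> W x \<le> W y"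
    and right: "\<And>x. continuous (at_right x) W"
  shows "(LINT x:{0..T}|interval_measure W. grid_step T n c x)
    = (\<Sum>i<n. c i * (W (grid T n (Suc i)) - W (grid T n i)))"
proof -
  have "(LINT x:{0..T}|interval_measure W. grid_step T n c x)
      = (LINT x|interval_measure W. grid_step T n c x)"
    unfolding set_lebesgue_integral_def
  proof (rule Bochner_Integration.integral_cong[OF refl])
    show "indicator {0..T} x *\<^sub>R grid_step T n c x = grid_step T n c x" for x
      using grid_step_outside[OF T, of x n c] by (cases "x \<in> {0<..T}") auto
  qed
  also have "\<dots> = (\<Sum>i<n. LINT x|interval_measure W. c i * indicator {grid T n i<..grid T n (Suc i)} x)"
    unfolding grid_step_def
    using mono right T
    by (intro Bochner_Integration.integral_sum integrable_mult_right integrable_real_indicator)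
      (auto simp: emeasure_interval_measure_Ioc grid_mono)
  also have "\<dots> = (\<Sum>i<n. c i * (W (grid T n (Suc i)) - W (grid T n i)))"
    using mono right T by (intro sum.cong) (auto simp: measure_interval_measure_Ioc grid_mono)
  finally show ?thesis .
qed

lemma set_nn_integral_grid_step:
  assumes T: "0 < T" and mono: "\<And>x y. x \<le> y \<Longrightarrow> W x \<le> W y"
    and right: "\<And>x. continuous (at_right x) W" and c: "\<And>i. i < n \<Longrightarrow> 0 \<le> c i"
  shows "(\<integral>\<^sup>+x\<in>{0..T}. ennreal (grid_step T n c x) \<partial>interval_measure W)
    = ennreal (\<Sum>i<n. c i * (W (grid T n (Suc i)) - W (grid T n i)))"
proof -
  have "(\<integral>\<^sup>+x\<in>{0..T}. ennreal (grid_step T n c x) \<partial>interval_measure W)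
      = (\<integral>\<^sup>+x. (\<Sum>i<n. ennreal (c i) * indicator {grid T n i<..grid T n (Suc i)} x) \<partial>interval_measure W)"
  proof (rule nn_integral_cong)
    fix x
    have "ennreal (grid_step T n c x) = (\<Sum>i<n. ennreal (c i * indicator {grid T n i<..grid T n (Suc i)} x))"
      unfolding grid_step_def using c by (intro sum_ennreal[symmetric]) auto
    also have "\<dots> = (\<Sum>i<n. ennreal (c i) * indicator {grid T n i<..grid T n (Suc i)} x)"
      by (intro sum.cong) (auto simp: indicator_def)
    finally show "ennreal (grid_step T n c x) * indicator {0..T} x
        = (\<Sum>i<n. ennreal (c i) * indicator {grid T n i<..grid T n (Suc i)} x)"
      using grid_step_outside[OF T, of x n c] by (cases "x \<in> {0..T}") auto
  qed
  also have "\<dots> = (\<Sum>i<n. \<integral>\<^sup>+x. ennreal (c i) * indicator {grid T n i<..grid T n (Suc i)} x \<partial>interval_measure W)"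
    by (rule nn_integral_sum) auto
  also have "\<dots> = (\<Sum>i<n. ennreal (c i) * ennreal (W (grid T n (Suc i)) - W (grid T n i)))"
    using mono right T
    by (intro sum.cong) (auto simp: nn_integral_cmult_indicator emeasure_interval_measure_Ioc grid_mono)
  also have "\<dots> = (\<Sum>i<n. ennreal (c i * (W (grid T n (Suc i)) - W (grid T n i))))"
    using c mono[OF grid_mono[OF T]] by (intro sum.cong refl ennreal_mult[symmetric]) auto
  also have "\<dots> = ennreal (\<Sum>i<n. c i * (W (grid T n (Suc i)) - W (grid T n i)))"
    using c mono[OF grid_mono[OF T]] by (intro sum_ennreal) (auto intro!: mult_nonneg_nonneg)
  finally show ?thesis .
qed

text \<open>A countable set of points without mass is null, so dominated convergence with a constant
  majorant on \<open>A\<close> applies. Measurability is asked only after multiplication by the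
  indicator, because the functions in question are controlled on \<open>A\<close> alone.\<close>

lemma set_integral_bounded_convergence:
  fixes h :: "real \<Rightarrow> real" and hn :: "nat \<Rightarrow> real \<Rightarrow> real"
  assumes M: "sets M = sets borel" and A: "A \<in> sets borel" "emeasure M A < \<infinity>"
    and meas: "(\<lambda>x. indicator A x * h x) \<in> borel_measurable borel"
    and measn: "\<And>n. (\<lambda>x. indicator A x * hn n x) \<in> borel_measurable borel"
    and bound: "\<And>n x. x \<in> A \<Longrightarrow> \<bar>hn n x\<bar> \<le> C"
    and N: "countable N" "\<And>x. x \<in> N \<Longrightarrow> emeasure M {x} = 0"
    and lim: "\<And>x. x \<in> A - N \<Longrightarrow> (\<lambda>n. hn n x) \<longlonglongrightarrow> h x"
  shows "(\<lambda>n. LINT x:A|M. hn n x) \<longlonglongrightarrow> (LINT x:A|M. h x)"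
  unfolding set_lebesgue_integral_def
proof (rule integral_dominated_convergence[where w = "\<lambda>x. C * indicator A x"])
  have "N = (\<Union>x\<in>N. {x})" by simp
  also have "\<dots> \<in> null_sets M"
    using N M by (intro null_sets_UN') (auto simp: null_sets_def)
  finally have null: "N \<in> null_sets M" .
  show "AE x in M. (\<lambda>n. indicator A x *\<^sub>R hn n x) \<longlonglongrightarrow> indicator A x *\<^sub>R h x"
  proof (rule AE_I'[OF null], rule subsetI, rule ccontr)
    fix x assume "x \<in> {x \<in> space M. \<not> (\<lambda>n. indicator A x *\<^sub>R hn n x) \<longlonglongrightarrow> indicator A x *\<^sub>R h x}"
      and "x \<notin> N"
    then show False using lim[of x] by (cases "x \<in> A") auto
  qed
  show "(\<lambda>x. indicator A x *\<^sub>R h x) \<in> borel_measurable M"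
    using meas M by (simp add: measurable_cong_sets[OF M refl])
  show "(\<lambda>x. indicator A x *\<^sub>R hn n x) \<in> borel_measurable M" for n
    using measn M by (simp add: measurable_cong_sets[OF M refl])
  show "integrable M (\<lambda>x. C * indicator A x)"
    using A M by (intro integrable_mult_right integrable_real_indicator) auto
  show "AE x in M. norm (indicator A x *\<^sub>R hn n x) \<le> C * indicator A x" for n
    using bound by (intro AE_I2) (auto simp: indicator_def)
qed

section \<open>The signed Lebesgue-Stieltjes integral\<close>

context
  fixes F :: "real \<Rightarrow> real"
  assumes bv: "bounded_variation_on F UNIV"
begin

lemmas right_limit_bv = bounded_variation_right_limit_bv[OF bv]

lemma ls_pos_fun_mono:
  "x \<le> y \<Longrightarrow> (variation_upto (right_limit F) x + right_limit F x) / 2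
    \<le> (variation_upto (right_limit F) y + right_limit F y) / 2"
  using variation_upto_increment[OF right_limit_bv, of x y] by argo

lemma ls_neg_fun_mono:
  "x \<le> y \<Longrightarrow> (variation_upto (right_limit F) x - right_limit F x) / 2
    \<le> (variation_upto (right_limit F) y - right_limit F y) / 2"
  using variation_upto_increment[OF right_limit_bv, of x y] by argo

lemma ls_fun_continuous:
  "continuous (at_right x) (variation_upto (right_limit F))"
  "continuous (at_right x) (\<lambda>x. (variation_upto (right_limit F) x + right_limit F x) / 2)"
  "continuous (at_right x) (\<lambda>x. (variation_upto (right_limit F) x - right_limit F x) / 2)"
  using right_limit_continuous[OF bv, of x]
    variation_upto_continuous_at_right[OF right_limit_bv right_limit_continuous[OF bv], of x]
  by (auto intro!: continuous_intros)

text \<open>In the difference of the positive and the negative part the variation function cancels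
  and the two halves of the right limit add up.\<close>

lemma ls_integral_grid_step:
  assumes "0 < T"
  shows "ls_integral F {0..T} (grid_step T n c)
    = (\<Sum>i<n. c i * (right_limit F (grid T n (Suc i)) - right_limit F (grid T n i)))"
proof -
  let ?V = "variation_upto (right_limit F)" and ?G = "right_limit F"
  have "ls_integral F {0..T} (grid_step T n c)
    = (\<Sum>i<n. c i * ((?V (grid T n (Suc i)) + ?G (grid T n (Suc i))) / 2
        - (?V (grid T n i) + ?G (grid T n i)) / 2))
    - (\<Sum>i<n. c i * ((?V (grid T n (Suc i)) - ?G (grid T n (Suc i))) / 2
        - (?V (grid T n i) - ?G (grid T n i)) / 2))"
    unfolding ls_integral_def ls_pos_def ls_neg_def
    by (intro arg_cong2[where f = "(-)"]
      set_integral_grid_step[OF assms, where W = "\<lambda>x. (?V x + ?G x) / 2"]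
      set_integral_grid_step[OF assms, where W = "\<lambda>x. (?V x - ?G x) / 2"]
      ls_pos_fun_mono ls_neg_fun_mono ls_fun_continuous)
  also have "\<dots> = (\<Sum>i<n. c i * (?G (grid T n (Suc i)) - ?G (grid T n i)))"
    unfolding sum_subtractf[symmetric] by (rule sum.cong) (auto simp: field_simps)
  finally show ?thesis .
qed

text \<open>Left continuity at the points of \<open>N\<close> passes from the right limit to its
  variation function, hence to the functions generating both parts of the measure. So neither part
  charges a point of \<open>N\<close>.\<close>

lemma ls_integral_bounded_convergence:
  fixes h :: "real \<Rightarrow> real" and hn :: "nat \<Rightarrow> real \<Rightarrow> real"
  assumes meas: "(\<lambda>x. indicator {0..T} x * h x) \<in> borel_measurable borel"
    and measn: "\<And>n. (\<lambda>x. indicator {0..T} x * hn n x) \<in> borel_measurable borel"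
    and bound: "\<And>n x. x \<in> {0..T} \<Longrightarrow> \<bar>hn n x\<bar> \<le> C"
    and N: "countable N" "\<And>x. x \<in> N \<Longrightarrow> continuous (at_left x) (right_limit F)"
    and lim: "\<And>x. x \<in> {0..T} - N \<Longrightarrow> (\<lambda>n. hn n x) \<longlonglongrightarrow> h x"
  shows "(\<lambda>n. ls_integral F {0..T} (hn n)) \<longlonglongrightarrow> ls_integral F {0..T} h"
  unfolding ls_integral_def ls_pos_def ls_neg_def
proof (intro tendsto_diff set_integral_bounded_convergence[OF _ _ _ meas measn bound N(1) _ lim]
    interval_measure_Icc_finite interval_measure_singleton ls_pos_fun_mono ls_neg_fun_mono
    ls_fun_continuous)
  fix x assume x: "x \<in> N"
  show "continuous (at_left x) (\<lambda>x. (variation_upto (right_limit F) x + right_limit F x) / 2)"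
    "continuous (at_left x) (\<lambda>x. (variation_upto (right_limit F) x - right_limit F x) / 2)"
    using N(2)[OF x] variation_upto_continuous_at_left[OF right_limit_bv N(2)[OF x]]
    by (auto intro!: continuous_intros)
qed auto

end

section \<open>Values of smallest modulus on a cell\<close>

text \<open>This is the point nearest to \<open>0\<close> in the interval from the infimum to the
  supremum: the infimum if that is positive, the supremum if that is negative, and \<open>0\<close>
  otherwise.\<close>

definition cell_value :: "(real \<Rightarrow> real) \<Rightarrow> real \<Rightarrow> real \<Rightarrow> real" where
  "cell_value g a b = max (Inf (g ` {a<..b})) 0 + min (Sup (g ` {a<..b})) 0"

lemma abs_cell_value_le:
  assumes "y \<in> {a<..b}" "\<And>x. x \<in> {a<..b} \<Longrightarrow> \<bar>g x\<bar> \<le> C"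
  shows "\<bar>cell_value g a b\<bar> \<le> \<bar>g y\<bar>"
proof -
  have "bdd_below (g ` {a<..b})" "bdd_above (g ` {a<..b})"
    using assms(2) by (auto intro!: bdd_belowI2[where m = "- C"] bdd_aboveI2[where M = C]
        simp: abs_le_iff minus_le_iff)
  then have "Inf (g ` {a<..b}) \<le> g y" "g y \<le> Sup (g ` {a<..b})"
    using assms(1) by (auto intro!: cInf_lower cSup_upper)
  then show ?thesis unfolding cell_value_def by (auto simp: max_def min_def)
qed

text \<open>A closed interval that contains the range of \<open>g\<close> on the cell contains its
  infimum and supremum, and hence the chosen value between them.\<close>

lemma cell_value_close:
  assumes ab: "a < b" and close: "\<And>y. y \<in> {a<..b} \<Longrightarrow> \<bar>g y - L\<bar> \<le> e"
  shows "\<bar>cell_value g a b - L\<bar> \<le> e"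
proof -
  have ne: "g ` {a<..b} \<noteq> {}" using ab by auto
  have *: "L - e \<le> g y" "g y \<le> L + e" if "y \<in> {a<..b}" for y using close[OF that] by auto
  have "L - e \<le> Inf (g ` {a<..b})" "Sup (g ` {a<..b}) \<le> L + e"
    using * by (auto intro!: cInf_greatest[OF ne] cSup_least[OF ne])
  moreover have "Inf (g ` {a<..b}) \<le> Sup (g ` {a<..b})"
    using * by (intro cInf_le_cSup ne) (auto intro!: bdd_belowI2[where m = "L - e"] bdd_aboveI2[where M = "L + e"])
  ultimately show ?thesis unfolding cell_value_def by (auto simp: max_def min_def)
qed

section \<open>Riemann sums for the integral against a function of bounded variation\<close>

lemma abel_summation:
  fixes p q :: "nat \<Rightarrow> 'a::comm_ring"
  shows "(\<Sum>i<n. p i * (q (Suc i) - q i)) = p n * q n - p 0 * q 0 - (\<Sum>i<n. q (Suc i) * (p (Suc i) - p i))"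
  by (induction n) (auto simp: algebra_simps)

section \<open>Functions of bounded variation on \<open>[0,T]\<close>\<close>

text \<open>The majorant \<open>v\<close> of \<open>f\<close> is raised by \<open>K\<close> at
  \<open>0\<close> and by at least \<open>K\<close> behind \<open>T\<close>, where \<open>K\<close>
  bounds the modulus of \<open>f\<close>. This pays for the two jumps of the extension.\<close>

lemma zero_extension_bv:
  assumes "f \<in> bv_functions T"
  shows "bounded_variation_on (zero_extension T f) UNIV"
proof -
  have bv: "bounded_variation_on f {0..T}" using assms by (simp add: bv_functions_def)
  obtain v C where v: "mono v" "\<And>x. 0 \<le> v x" "\<And>x. v x \<le> C"
    "\<And>x y. x \<in> {0..T} \<Longrightarrow> y \<in> {0..T} \<Longrightarrow> x \<le> y \<Longrightarrow> \<bar>f y - f x\<bar> \<le> v y - v x"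
    by (rule bounded_variation_onE[OF bv]) blast
  obtain K where K: "0 \<le> K" "\<And>x. x \<in> {0..T} \<Longrightarrow> \<bar>f x\<bar> \<le> K"
    by (rule bounded_variation_on_bounded[OF bv]) blast
  define w where "w x = (if x < 0 then 0 else if x \<le> T then K + v x else 2 * K + C)" for x
  have C: "0 \<le> C" using v(2)[of 0] v(3)[of 0] by linarith
  show ?thesis
  proof (rule bounded_variation_onI[where v = w and C = "2 * K + C"])
    fix x y :: real assume "x \<le> y"
    then show "\<bar>zero_extension T f y - zero_extension T f x\<bar> \<le> w y - w x"
      using v(4)[of x y] K(2)[of x] K(2)[of y] K(1) v(2)[of y] v(3)[of x] C
      by (auto simp: zero_extension_def w_def)
  next
    have "0 \<le> w x" "w x \<le> 2 * K + C" for x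
      using K(1) v(2,3)[of x] C by (auto simp: w_def)
    then show "w y - w x \<le> 2 * K + C" for x y by (smt (verit))
  qed
qed

lemma bv_functions_borel_measurable:
  assumes "f \<in> bv_functions T"
  shows "zero_extension T f \<in> borel_measurable borel"
proof -
  obtain v C where v: "mono v" "\<And>x. 0 \<le> v x" "\<And>x. v x \<le> C"
    "\<And>x y. x \<le> y \<Longrightarrow> \<bar>zero_extension T f y - zero_extension T f x\<bar> \<le> v y - v x"
    by (rule bounded_variation_onE[OF zero_extension_bv[OF assms]]) blast
  have "mono (\<lambda>y. v y + zero_extension T f y)" by (rule monoI) (use v(4) in \<open>smt (verit)\<close>)
  from borel_measurable_diff[OF borel_measurable_mono[OF this] borel_measurable_mono[OF v(1)]]
  show ?thesis by simp
qed

text \<open>Where the monotone majorant is continuous, so is \<open>f\<close> relative to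
  \<open>[0,T]\<close>, and a monotone function has only countably many discontinuities.\<close>

lemma bv_functions_countable_discontinuities:
  assumes "f \<in> bv_functions T"
  shows "countable {x \<in> {0..T}. \<not> continuous (at x within {0..T}) f}"
proof -
  obtain v C where v: "mono v" "\<And>x. 0 \<le> v x" "\<And>x. v x \<le> C"
    "\<And>x y. x \<in> {0..T} \<Longrightarrow> y \<in> {0..T} \<Longrightarrow> x \<le> y \<Longrightarrow> \<bar>f y - f x\<bar> \<le> v y - v x"
    by (rule bounded_variation_onE[of f "{0..T}"]) (use assms in \<open>auto simp: bv_functions_def\<close>)
  have "continuous (at x within {0..T}) f" if x: "x \<in> {0..T}" "isCont v x" for x
    unfolding continuous_within
  proof (rule LIM_zero_cancel, rule Lim_null_comparison)
    have "(v \<longlongrightarrow> v x) (at x within {0..T})"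
      using x(2) unfolding isCont_def by (rule tendsto_within_subset) simp
    then show "((\<lambda>y. \<bar>v y - v x\<bar>) \<longlongrightarrow> 0) (at x within {0..T})"
      by (intro tendsto_rabs_zero LIM_zero)
    have "\<bar>f y - f x\<bar> \<le> \<bar>v y - v x\<bar>" if "y \<in> {0..T}" for y
      using v(4)[OF that x(1)] v(4)[OF x(1) that] by (cases "x \<le> y") auto
    then show "eventually (\<lambda>y. norm (f y - f x) \<le> \<bar>v y - v x\<bar>) (at x within {0..T})"
      by (auto simp: eventually_at_filter)
  qed
  then show ?thesis
    by (intro countable_subset[OF _ mono_ctble_discont[OF v(1)]]) auto
qed

lemma bv_functions_bounded:
  assumes "f \<in> bv_functions T"
  obtains C where "0 \<le> C" "\<And>x. x \<in> {0..T} \<Longrightarrow> \<bar>f x\<bar> \<le> C"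
  by (rule bounded_variation_on_bounded[of f "{0..T}"]) (use assms in \<open>auto simp: bv_functions_def\<close>)

definition cell_values :: "real \<Rightarrow> (real \<Rightarrow> real) \<Rightarrow> nat \<Rightarrow> nat \<Rightarrow> real" where
  "cell_values T g n i = cell_value g (grid T n i) (grid T n (Suc i))"

lemma cell_values_tendsto:
  assumes "0 < T" "x \<in> {0<..T}" "continuous (at x within {0..T}) g"
  shows "(\<lambda>n. grid_step T n (cell_values T g n) x) \<longlonglongrightarrow> g x"
proof (rule grid_step_tendsto[OF assms])
  fix n i e assume i: "i < (n::nat)"
    and *: "\<And>y. y \<in> {grid T n i..grid T n (Suc i)} \<Longrightarrow> \<bar>g y - g x\<bar> \<le> e"
  show "\<bar>cell_values T g n i - g x\<bar> \<le> e"
    unfolding cell_values_def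
    using i by (intro cell_value_close grid_less_Suc assms *) auto
qed

text \<open>The cell value has the smallest modulus, and the step function vanishes at
  \<open>0\<close> and for \<open>n = 0\<close>. This bound is what makes the later dominations by
  \<open>f\<close> and by \<open>g\<close> possible.\<close>

lemma abs_cell_values_le:
  assumes T: "0 < T" and g: "g \<in> bv_functions T" and x: "x \<in> {0..T}"
  shows "\<bar>grid_step T n (cell_values T g n) x\<bar> \<le> \<bar>g x\<bar>"
proof (cases "0 < n \<and> x \<in> {0<..T}")
  case True
  obtain C where C: "\<And>x. x \<in> {0..T} \<Longrightarrow> \<bar>g x\<bar> \<le> C" using bv_functions_bounded[OF g] by blast
  obtain i where i: "i < n" "x \<in> {grid T n i<..grid T n (Suc i)}"
    using grid_cellE[OF T, of n x] True by blast
  have "\<bar>cell_values T g n i\<bar> \<le> \<bar>g x\<bar>"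
    unfolding cell_values_def
    by (rule abs_cell_value_le[OF i(2), where C = C]) (use C grid_cell_subset[OF T i(1)] in auto)
  then show ?thesis by (simp add: grid_step_eq[OF T i])
next
  case False
  then have "grid_step T n (cell_values T g n) x = 0"
    using grid_step_outside[OF T, of x] by (cases "n = 0") (auto simp: grid_step_def)
  then show ?thesis by simp
qed

section \<open>Integration by parts through Riemann sums\<close>

text \<open>The sums \<open>A n\<close> of left-end values of \<open>\<psi>\<close> times increments
  of \<open>G\<close> tend to the integral against the measure of \<open>g\<close>. Abel summation
  turns them into sums of \<open>G\<close> at right ends times increments of \<open>\<psi>\<close>;
  the boundary terms vanish by \<open>\<psi> 0 = 0\<close> and \<open>G T = 0\<close>. Replacing
  \<open>G\<close> by the cell values costs at most a bounded total variation times the oscillation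
  of \<open>\<psi>\<close> on a cell.\<close>

lemma nu_integral_tendsto:
  assumes T: "0 < T" and g: "g \<in> bv_functions T"
    and cont: "continuous_on {0..T} \<psi>" and zero: "\<psi> 0 = 0"
  shows "(\<lambda>n. \<Sum>i<n. cell_values T g n i * (\<psi> (grid T n (Suc i)) - \<psi> (grid T n i)))
    \<longlonglongrightarrow> - nu_integral T g \<psi>"
proof -
  define Z where "Z = zero_extension T g"
  define G where "G = right_limit Z"
  have bvZ: "bounded_variation_on Z UNIV" unfolding Z_def by (rule zero_extension_bv[OF g])
  \<comment> \<open>The extension is \<open>0\<close> to the right of \<open>T\<close>, so the value
    of \<open>g\<close> at \<open>T\<close> is lost in the right limit; it enters the measure as a
    jump at \<open>T\<close>.\<close>
  have GT: "G T = 0"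
  proof -
    have "eventually (\<lambda>y. Z y = 0) (at_right T)"
      using eventually_at_right_less[of T] by (auto elim!: eventually_mono simp: Z_def zero_extension_def)
    then have "(Z \<longlongrightarrow> 0) (at_right T)" by (rule tendsto_eventually)
    then show ?thesis
      unfolding G_def right_limit_def by (rule tendsto_Lim[OF trivial_limit_at_right_real])
  qed
  define A where "A n = (\<Sum>i<n. \<psi> (grid T n i) * (G (grid T n (Suc i)) - G (grid T n i)))" for n
  define B where "B n = (\<Sum>i<n. cell_values T g n i * (\<psi> (grid T n (Suc i)) - \<psi> (grid T n i)))" for n
  have A: "A \<longlonglongrightarrow> nu_integral T g \<psi>"
  proof -
    obtain C where C: "\<And>x. x \<in> {0..T} \<Longrightarrow> \<bar>\<psi> x\<bar> \<le> C"
      using compact_continuous_image[OF cont compact_Icc, THEN compact_imp_bounded]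
      unfolding bounded_iff by (metis image_eqI real_norm_def)
    have bound: "\<bar>grid_step T n (\<lambda>i. \<psi> (grid T n i)) x\<bar> \<le> C" for n x
    proof (cases "0 < n \<and> x \<in> {0<..T}")
      case True
      obtain i where i: "i < n" "x \<in> {grid T n i<..grid T n (Suc i)}"
        using grid_cellE[OF T, of n x] True by blast
      show ?thesis unfolding grid_step_eq[OF T i] by (intro C grid_mem T less_imp_le i)
    next
      case False
      then have "grid_step T n (\<lambda>i. \<psi> (grid T n i)) x = 0"
        using grid_step_outside[OF T, of x] by (cases "n = 0") (auto simp: grid_step_def)
      then show ?thesis using C[of 0] T by auto
    qed
    have "(\<lambda>n. ls_integral Z {0..T} (grid_step T n (\<lambda>i. \<psi> (grid T n i)))) \<longlonglongrightarrow> ls_integral Z {0..T} \<psi>"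
    proof (rule ls_integral_bounded_convergence[OF bvZ _ _ bound, where N = "{}"])
      show "(\<lambda>x. indicator {0..T} x * \<psi> x) \<in> borel_measurable borel"
        using borel_measurable_continuous_on_indicator[OF _ cont] by simp
      show "(\<lambda>n. grid_step T n (\<lambda>i. \<psi> (grid T n i)) x) \<longlonglongrightarrow> \<psi> x" if "x \<in> {0..T} - {}" for x
      proof (cases "x = 0")
        case True
        then show ?thesis using zero T by (simp add: grid_step_outside)
      next
        case False
        show ?thesis
        proof (rule grid_step_tendsto[OF T])
          show "continuous (at x within {0..T}) \<psi>"
            using cont that by (simp add: continuous_on_eq_continuous_within)
          show "\<bar>\<psi> (grid T n i) - \<psi> x\<bar> \<le> e"
            if "\<And>y. y \<in> {grid T n i..grid T n (Suc i)} \<Longrightarrow> \<bar>\<psi> y - \<psi> x\<bar> \<le> e" for n i e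
            using T by (intro that) (simp add: grid_mono)
        qed (use False that in auto)
      qed
    qed auto
    then show ?thesis
      unfolding nu_integral_def A_def ls_integral_grid_step[OF bvZ T] G_def Z_def[symmetric] by simp
  qed
  obtain v C where v: "mono v" "\<And>x. 0 \<le> v x" "\<And>x. v x \<le> C"
    "\<And>x y. x \<le> y \<Longrightarrow> \<bar>Z y - Z x\<bar> \<le> v y - v x"
    by (rule bounded_variation_onE[OF bvZ]) blast
  have C: "0 \<le> C" using v(2)[of 0] v(3)[of 0] by linarith
  \<comment> \<open>The right limit at the right end of a cell depends on values in the next cell.
    Hence the bound extends over two cells, and for the last cell it reaches beyond
    \<open>T\<close>.\<close>
  have close: "\<bar>cell_values T g n i - G (grid T n (Suc i))\<bar> \<le> v (grid T n (Suc (Suc i))) - v (grid T n i)"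
    if "i < n" for n i
    unfolding cell_values_def
  proof (rule cell_value_close)
    let ?s = "grid T n"
    show "?s i < ?s (Suc i)" using that T by (simp add: grid_less_Suc)
    fix y assume y: "y \<in> {?s i<..?s (Suc i)}"
    have lt: "?s (Suc i) < ?s (Suc (Suc i))" using that T by (simp add: grid_less_Suc)
    have gZ: "g y = Z y"
      using y grid_cell_subset[OF T that] by (auto simp: Z_def zero_extension_def subset_iff)
    have "((\<lambda>z. \<bar>Z y - Z z\<bar>) \<longlongrightarrow> \<bar>Z y - G (?s (Suc i))\<bar>) (at_right (?s (Suc i)))"
      unfolding G_def by (intro tendsto_intros bounded_variation_right_limit bvZ)
    moreover have "eventually (\<lambda>z. \<bar>Z y - Z z\<bar> \<le> v (?s (Suc (Suc i))) - v (?s i)) (at_right (?s (Suc i)))"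
      unfolding eventually_at_right[OF lt]
    proof (intro exI[of _ "?s (Suc (Suc i))"] conjI lt allI impI)
      fix z assume z: "?s (Suc i) < z" "z < ?s (Suc (Suc i))"
      then have "v z \<le> v (?s (Suc (Suc i)))" "v (?s i) \<le> v y"
        using y by (auto intro!: monoD[OF v(1)])
      then show "\<bar>Z y - Z z\<bar> \<le> v (?s (Suc (Suc i))) - v (?s i)"
        using v(4)[of y z] z y by auto
    qed
    ultimately show "\<bar>g y - G (?s (Suc i))\<bar> \<le> v (?s (Suc (Suc i))) - v (?s i)"
      unfolding gZ by (intro tendsto_upperbound) auto
  qed
  have "(\<lambda>n. A n + B n) \<longlonglongrightarrow> 0"
  proof (rule LIMSEQ_I)
    fix e :: real assume "0 < e"
    \<comment> \<open>The two-cell increments of \<open>v\<close> will add up to at most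
      \<open>2 * C\<close>; the \<open>+ 1\<close> covers \<open>C = 0\<close> and makes the final
      inequality strict.\<close>
    define e' where "e' = e / (2 * C + 1)"
    have e': "0 < e'" using \<open>0 < e\<close> C by (simp add: e'_def)
    have "uniformly_continuous_on {0..T} \<psi>"
      by (rule compact_uniformly_continuous[OF cont compact_Icc])
    then obtain d where d: "0 < d"
      "\<And>x y. x \<in> {0..T} \<Longrightarrow> y \<in> {0..T} \<Longrightarrow> dist y x < d \<Longrightarrow> dist (\<psi> y) (\<psi> x) < e'"
      unfolding uniformly_continuous_on_def using e' by meson
    obtain k :: nat where k: "T / d < real k" using reals_Archimedean2 by blast
    show "\<exists>no. \<forall>n\<ge>no. norm (A n + B n - 0) < e"
    proof (intro exI allI impI)
      fix n assume "max k 1 \<le> n"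
      then have n: "0 < n" "T / d < real n" using k by auto
      then have n_d: "T / real n < d" using d(1) by (simp add: field_simps)
      let ?s = "grid T n"
      have "A n = - (\<Sum>i<n. G (?s (Suc i)) * (\<psi> (?s (Suc i)) - \<psi> (?s i)))"
        unfolding A_def abel_summation[of "\<lambda>i. \<psi> (?s i)" "\<lambda>i. G (?s i)"]
        using n zero GT by simp
      then have "A n + B n = (\<Sum>i<n. (cell_values T g n i - G (?s (Suc i))) * (\<psi> (?s (Suc i)) - \<psi> (?s i)))"
        unfolding B_def by (simp add: sum_subtractf left_diff_distrib)
      also have "\<bar>\<dots>\<bar> \<le> (\<Sum>i<n. (v (?s (Suc (Suc i))) - v (?s i)) * e')"
      proof (rule order_trans[OF sum_abs], rule sum_mono)
        fix i assume "i \<in> {..<n}"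
        then have i: "i < n" by simp
        have "dist (?s (Suc i)) (?s i) < d"
          using n_d T by (simp add: dist_real_def grid_Suc)
        then have "\<bar>\<psi> (?s (Suc i)) - \<psi> (?s i)\<bar> \<le> e'"
          using d(2)[OF grid_mem[OF T, of i n] grid_mem[OF T, of "Suc i" n]] i
          by (simp add: dist_real_def)
        then show "\<bar>(cell_values T g n i - G (?s (Suc i))) * (\<psi> (?s (Suc i)) - \<psi> (?s i))\<bar>
            \<le> (v (?s (Suc (Suc i))) - v (?s i)) * e'"
          unfolding abs_mult using close[OF i] by (intro mult_mono) auto
      qed
      \<comment> \<open>Each two-cell increment is split into its two cells, which leaves two
        telescoping sums of size at most \<open>C\<close> each.\<close>
      also have "\<dots> = (\<Sum>i<n. (v (?s (Suc (Suc i))) - v (?s (Suc i))) + (v (?s (Suc i)) - v (?s i))) * e'"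
        unfolding sum_distrib_right by (rule sum.cong) auto
      also have "(\<Sum>i<n. (v (?s (Suc (Suc i))) - v (?s (Suc i))) + (v (?s (Suc i)) - v (?s i)))
          = (v (?s (Suc n)) - v (?s (Suc 0))) + (v (?s n) - v (?s 0))"
        unfolding sum.distrib sum_lessThan_telescope[of "\<lambda>i. v (?s (Suc i))"]
          sum_lessThan_telescope[of "\<lambda>i. v (?s i)"] ..
      also have "\<dots> * e' \<le> (2 * C) * e'"
        using v(2)[of "?s (Suc 0)"] v(2)[of "?s 0"] v(3)[of "?s (Suc n)"] v(3)[of "?s n"] e'
        by (intro mult_right_mono) auto
      also have "\<dots> < e" using \<open>0 < e\<close> C by (simp add: e'_def field_simps)
      finally show "norm (A n + B n - 0) < e" by simp
    qed
  qed
  from tendsto_diff[OF this A] show ?thesis unfolding B_def by simp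
qed

section \<open>Absolutely continuous functions\<close>

lemma sum_lengths_le_measure:
  fixes u v :: "'i \<Rightarrow> real"
  assumes I: "finite I" and le: "\<And>i. i \<in> I \<Longrightarrow> u i \<le> v i"
    and disj: "disjoint_family_on (\<lambda>i. {u i<..<v i}) I"
    and sub: "\<And>i. i \<in> I \<Longrightarrow> {u i<..<v i} \<subseteq> U" and U: "U \<in> sets lebesgue"
  shows "ennreal (\<Sum>i\<in>I. v i - u i) \<le> emeasure lebesgue U"
proof -
  have "ennreal (\<Sum>i\<in>I. v i - u i) = (\<Sum>i\<in>I. emeasure lebesgue {u i<..<v i})"
    using le by (simp flip: sum_ennreal)
  also have "\<dots> = emeasure lebesgue (\<Union>i\<in>I. {u i<..<v i})"
    using disj I by (intro sum_emeasure) auto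
  also have "\<dots> \<le> emeasure lebesgue U" using sub U by (intro emeasure_mono) auto
  finally show ?thesis .
qed

lemma absolutely_continuous_fun_on_subset:
  "absolutely_continuous_fun_on a b F \<Longrightarrow> a \<le> c \<Longrightarrow> d \<le> b \<Longrightarrow> absolutely_continuous_fun_on c d F"
  unfolding absolutely_continuous_fun_on_def by (meson order_trans)

text \<open>The condition of absolute continuity for one fixed pair, named so that the same
  \<open>\<delta>\<close> can be applied to families indexed by arbitrary finite sets.\<close>

definition small_increments :: "real \<Rightarrow> real \<Rightarrow> (real \<Rightarrow> real) \<Rightarrow> real \<Rightarrow> real \<Rightarrow> bool" where
  "small_increments a b F \<delta> \<epsilon> \<longleftrightarrow> (\<forall>(n::nat) (u::nat \<Rightarrow> real) v.
        (\<forall>i<n. a \<le> u i \<and> u i \<le> v i \<and> v i \<le> b)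
        \<and> disjoint_family_on (\<lambda>i. {u i<..<v i}) {..<n}
        \<and> (\<Sum>i<n. v i - u i) < \<delta>
        \<longrightarrow> (\<Sum>i<n. \<bar>F (v i) - F (u i)\<bar>) < \<epsilon>)"

lemma absolutely_continuous_fun_onD:
  assumes "absolutely_continuous_fun_on a b F" "0 < \<epsilon>"
  obtains \<delta> where "0 < \<delta>" "small_increments a b F \<delta> \<epsilon>"
  using assms unfolding absolutely_continuous_fun_on_def small_increments_def by blast

text \<open>An enumeration of \<open>I\<close> reduces this to families indexed by initial segments.
  The index sets of interest are sets of pieces, tagged or not, of a division.\<close>

lemma small_incrementsD:
  fixes u v :: "'i \<Rightarrow> real"
  assumes ac: "small_increments a b F \<delta> \<epsilon>" and I: "finite I"
    and uv: "\<And>i. i \<in> I \<Longrightarrow> a \<le> u i \<and> u i \<le> v i \<and> v i \<le> b"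
    and disj: "disjoint_family_on (\<lambda>i. {u i<..<v i}) I"
    and len: "(\<Sum>i\<in>I. v i - u i) < \<delta>"
  shows "(\<Sum>i\<in>I. \<bar>F (v i) - F (u i)\<bar>) < \<epsilon>"
proof -
  obtain h where "bij_betw h {0..<card I} I"
    using ex_bij_betw_nat_finite[OF I] by blast
  then have h: "bij_betw h {..<card I} I" by (simp add: lessThan_atLeast0)
  have sum: "(\<Sum>i<card I. k (h i)) = (\<Sum>i\<in>I. k i)" for k :: "'i \<Rightarrow> real"
    by (rule sum.reindex_bij_betw[OF h])
  have hI: "h i \<in> I" if "i < card I" for i using h that by (auto simp: bij_betw_def)
  have "disjoint_family_on (\<lambda>i. {u (h i)<..<v (h i)}) {..<card I}"
    unfolding disjoint_family_on_def
  proof (intro ballI impI)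
    fix i j assume "i \<in> {..<card I}" "j \<in> {..<card I}" "i \<noteq> j"
    then have "h i \<noteq> h j" "h i \<in> I" "h j \<in> I"
      using h hI by (auto simp: bij_betw_def inj_on_def)
    then show "{u (h i)<..<v (h i)} \<inter> {u (h j)<..<v (h j)} = {}"
      using disj by (auto simp: disjoint_family_on_def)
  qed
  moreover have "(\<Sum>i<card I. v (h i) - u (h i)) < \<delta>"
    using len unfolding sum[of "\<lambda>i. v i - u i"] .
  ultimately have "(\<Sum>i<card I. \<bar>F (v (h i)) - F (u (h i))\<bar>) < \<epsilon>"
    using ac[unfolded small_increments_def, rule_format, of "card I" "\<lambda>i. u (h i)" "\<lambda>i. v (h i)"] uv hI
    by blast
  then show ?thesis unfolding sum[of "\<lambda>i. \<bar>F (v i) - F (u i)\<bar>"] .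
qed

section \<open>The fundamental theorem of calculus for absolutely continuous functions\<close>

text \<open>Since \<open>x\<close> lies between \<open>u\<close> and \<open>v\<close>, the errors of
  the linear approximation on both sides are bounded by \<open>e * (x - u)\<close> and
  \<open>e * (v - x)\<close>, and these add up to \<open>e * (v - u)\<close>.\<close>

lemma straddle:
  fixes F :: "real \<Rightarrow> real"
  assumes der: "(F has_real_derivative f') (at x within {a..b})" and "0 < e"
  obtains d where "0 < d"
    "\<And>u v. u \<in> {a..b} \<Longrightarrow> v \<in> {a..b} \<Longrightarrow> u \<le> x \<Longrightarrow> x \<le> v \<Longrightarrow> dist u x < d \<Longrightarrow> dist v x < d
      \<Longrightarrow> \<bar>(v - u) * f' - (F v - F u)\<bar> \<le> e * (v - u)"
proof -
  obtain d where d: "0 < d" "\<And>y. y \<in> {a..b} \<Longrightarrow> norm (y - x) < d \<Longrightarrow>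
      norm (F y - F x - f' * (y - x)) \<le> e * norm (y - x)"
    using der assms(2) unfolding has_field_derivative_def has_derivative_within_alt by blast
  show thesis
  proof (rule that[OF d(1)])
    fix u v assume uv: "u \<in> {a..b}" "v \<in> {a..b}" "u \<le> x" "x \<le> v" "dist u x < d" "dist v x < d"
    have "\<bar>F u - F x - f' * (u - x)\<bar> \<le> e * (x - u)" "\<bar>F v - F x - f' * (v - x)\<bar> \<le> e * (v - x)"
      using d(2)[of u] d(2)[of v] uv by (auto simp: dist_real_def)
    then show "\<bar>(v - u) * f' - (F v - F u)\<bar> \<le> e * (v - u)"
      by (simp add: algebra_simps abs_le_iff)
  qed
qed

text \<open>A Henstock-Kurzweil argument with a null set \<open>N\<close> containing all bad points.
  Pieces tagged outside \<open>N\<close> are controlled by \<open>straddle\<close>. The gauge forces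
  pieces tagged in \<open>N\<close> into an open set of measure below \<open>\<delta>\<close>, so
  absolute continuity bounds the increments of \<open>F\<close> over them. Each kind gets half of
  the error.\<close>

lemma absolutely_continuous_has_integral:
  assumes ab: "a \<le> b" and ac: "absolutely_continuous_fun_on a b F"
    and der: "AE t in lebesgue. t \<in> {a..b} \<longrightarrow> (F has_real_derivative f t) (at t within {a..b})"
  shows "(f has_integral F b - F a) {a..b}"
proof (cases "a = b")
  case False
  with ab have less: "a < b" by simp
  obtain N where N: "N \<in> null_sets lebesgue"
    "{t. \<not> (t \<in> {a..b} \<longrightarrow> (F has_real_derivative f t) (at t within {a..b}))} \<subseteq> N"
    using der by (auto simp: eventually_ae_filter)
  \<comment> \<open>With the integrand \<open>0\<close> on \<open>N\<close>, a piece tagged there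
    contributes only its increment of \<open>F\<close>; the change does not affect the
    integral.\<close>
  define f' where "f' t = (if t \<in> N then 0 else f t)" for t
  have "(f' has_integral F b - F a) {a..b}"
    unfolding has_integral_factor_content box_real[symmetric]
  proof (intro allI impI)
    fix e :: real assume "0 < e"
    obtain \<delta> where \<delta>: "0 < \<delta>" "small_increments a b F \<delta> (e / 2 * (b - a))"
      by (rule absolutely_continuous_fun_onD[OF ac, of "e / 2 * (b - a)"]) (use \<open>0 < e\<close> less in auto)
    obtain U where U: "open U" "N \<subseteq> U" "emeasure lebesgue (U - N) < ennreal \<delta>"
      by (rule sets_lebesgue_outer_open[of N \<delta>]) (use N(1) \<delta>(1) in auto)
    \<comment> \<open>Outer approximation controls only \<open>U - N\<close>; as \<open>N\<close> is
      null, the same bound holds for \<open>U\<close>.\<close>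
    have "emeasure lebesgue U = emeasure lebesgue (U - N)"
      using U(1) N(1) by (intro emeasure_Diff_null_set[symmetric]) auto
    with U(3) have U_less: "emeasure lebesgue U < ennreal \<delta>" by simp
    have "\<exists>d>0. (x \<in> N \<longrightarrow> ball x d \<subseteq> U) \<and> (x \<in> {a..b} - N \<longrightarrow> (\<forall>u v. u \<in> {a..b} \<and> v \<in> {a..b}
        \<and> u \<le> x \<and> x \<le> v \<and> dist u x < d \<and> dist v x < d
        \<longrightarrow> \<bar>(v - u) * f x - (F v - F u)\<bar> \<le> e / 2 * (v - u)))" for x
    proof (cases "x \<in> N")
      case True
      then show ?thesis using U(1,2) open_contains_ball by (metis DiffD2 subsetD)
    next
      case xN: False
      show ?thesis
      proof (cases "x \<in> {a..b}")
        case True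
        have "(F has_real_derivative f x) (at x within {a..b})" using N(2) xN True by blast
        then obtain d where "0 < d"
          "\<And>u v. u \<in> {a..b} \<Longrightarrow> v \<in> {a..b} \<Longrightarrow> u \<le> x \<Longrightarrow> x \<le> v \<Longrightarrow> dist u x < d \<Longrightarrow> dist v x < d
            \<Longrightarrow> \<bar>(v - u) * f x - (F v - F u)\<bar> \<le> e / 2 * (v - u)"
          by (rule straddle[of F "f x" x a b "e / 2"]) (use \<open>0 < e\<close> in auto)
        then show ?thesis using xN by blast
      qed (use xN in \<open>auto intro: exI[of _ 1]\<close>)
    qed
    then obtain d where d: "\<And>x. 0 < d x" "\<And>x. x \<in> N \<Longrightarrow> ball x (d x) \<subseteq> U"
      "\<And>x u v. x \<in> {a..b} - N \<Longrightarrow> u \<in> {a..b} \<Longrightarrow> v \<in> {a..b} \<Longrightarrow> u \<le> x \<Longrightarrow> x \<le> v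
        \<Longrightarrow> dist u x < d x \<Longrightarrow> dist v x < d x
        \<Longrightarrow> \<bar>(v - u) * f x - (F v - F u)\<bar> \<le> e / 2 * (v - u)"
      by metis
    show "\<exists>\<gamma>. gauge \<gamma> \<and> (\<forall>p. p tagged_division_of cbox a b \<and> \<gamma> fine p \<longrightarrow>
      norm ((\<Sum>(x, K)\<in>p. measure lborel K *\<^sub>R f' x) - (F b - F a)) \<le> e * measure lborel (cbox a b))"
    proof (rule exI, intro conjI allI impI)
      show "gauge (\<lambda>x. ball x (d x))" using d(1) gauge_ball_dependent by blast
      fix p assume "p tagged_division_of cbox a b \<and> (\<lambda>x. ball x (d x)) fine p"
      then have tag: "p tagged_division_of cbox a b" and fine: "(\<lambda>x. ball x (d x)) fine p" by auto
      have tag': "p tagged_division_of {a..b}" using tag by simp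
      have fin: "finite p" using tag by blast
      \<comment> \<open>The end points of a piece are recovered as \<open>Inf K\<close> and
        \<open>Sup K\<close>, so that families of intervals can be indexed by the pieces
        themselves.\<close>
      have K: "K = {Inf K..Sup K}" "Inf K \<le> x" "x \<le> Sup K" "Inf K \<in> {a..b}" "Sup K \<in> {a..b}"
          "dist (Inf K) x < d x" "dist (Sup K) x < d x"
        if xK: "(x, K) \<in> p" for x K
      proof -
        obtain u v where uv: "K = cbox u v" using tagged_division_ofD(4)[OF tag xK] by blast
        have "x \<in> K" using tagged_division_ofD(2)[OF tag xK] .
        then have IS: "Inf K = u" "Sup K = v" and le: "u \<le> x" "x \<le> v" using uv by auto
        have "K \<subseteq> {a..b}" "K \<subseteq> ball x (d x)"
          using tagged_division_ofD(3)[OF tag xK] fine xK by (auto simp: fine_def)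
        moreover have "u \<in> K" "v \<in> K" using le uv by auto
        ultimately have "u \<in> {a..b}" "v \<in> {a..b}" "dist x u < d x" "dist x v < d x"
          by (auto simp: subset_iff simp del: cbox_interval)
        then show "K = {Inf K..Sup K}" "Inf K \<le> x" "x \<le> Sup K" "Inf K \<in> {a..b}" "Sup K \<in> {a..b}"
          "dist (Inf K) x < d x" "dist (Sup K) x < d x"
          unfolding IS using uv le by (auto simp: dist_commute)
      qed
      let ?pN = "{(x, K) \<in> p. x \<in> N}"
      have int: "interior K = {Inf K<..<Sup K}" if "(x, K) \<in> p" for x K
        using arg_cong[OF K(1)[OF that], of interior] by simp
      have disj: "disjoint_family_on (\<lambda>i. {Inf (snd i)<..<Sup (snd i)}) ?pN"
        unfolding disjoint_family_on_def
      proof (intro ballI impI)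
        fix i j assume "i \<in> ?pN" "j \<in> ?pN" "i \<noteq> j"
        then show "{Inf (snd i)<..<Sup (snd i)} \<inter> {Inf (snd j)<..<Sup (snd j)} = {}"
          using tagged_division_ofD(5)[OF tag, of "fst i" "snd i" "fst j" "snd j"]
            int[of "fst i" "snd i"] int[of "fst j" "snd j"] by auto
      qed
      have finN: "finite ?pN" by (rule finite_subset[OF _ fin]) auto
      have "ennreal (\<Sum>i\<in>?pN. Sup (snd i) - Inf (snd i)) \<le> emeasure lebesgue U"
      proof (rule sum_lengths_le_measure[OF finN _ disj])
        fix i assume "i \<in> ?pN"
        then obtain x K' where i: "i = (x, K')" "(x, K') \<in> p" "x \<in> N" by auto
        show "Inf (snd i) \<le> Sup (snd i)" using K(2,3)[OF i(2)] i(1) by simp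
        have "K' \<subseteq> ball x (d x)" using fine i(2) by (auto simp: fine_def)
        then have "K' \<subseteq> U" using d(2)[OF i(3)] by blast
        moreover have "{Inf K'<..<Sup K'} \<subseteq> {Inf K'..Sup K'}" by auto
        ultimately show "{Inf (snd i)<..<Sup (snd i)} \<subseteq> U"
          unfolding i(1) snd_conv K(1)[OF i(2), symmetric] by (rule order_trans[rotated])
      qed (use U(1) in auto)
      also note U_less
      finally have "(\<Sum>i\<in>?pN. Sup (snd i) - Inf (snd i)) < \<delta>"
        by (subst (asm) ennreal_less_iff) (auto intro!: sum_nonneg intro: order_trans[OF K(2) K(3)])
      then have sumN: "(\<Sum>i\<in>?pN. \<bar>F (Sup (snd i)) - F (Inf (snd i))\<bar>) < e / 2 * (b - a)"
      proof (rule small_incrementsD[OF \<delta>(2) finN _ disj, rotated])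
        fix i assume "i \<in> ?pN"
        then have "(fst i, snd i) \<in> p" by auto
        from K(2-5)[OF this]
        show "a \<le> Inf (snd i) \<and> Inf (snd i) \<le> Sup (snd i) \<and> Sup (snd i) \<le> b" by auto
      qed
      have "(\<Sum>(x, K)\<in>p. measure lborel K *\<^sub>R f' x) - (F b - F a)
          = (\<Sum>(x, K)\<in>p. measure lborel K * f' x - (F (Sup K) - F (Inf K)))"
        unfolding additive_tagged_division_1[OF ab tag', of F, symmetric]
        by (simp add: sum_subtractf case_prod_beta)
      also have "\<bar>\<dots>\<bar> \<le> (\<Sum>i\<in>p. e / 2 * (Sup (snd i) - Inf (snd i))
          + (if i \<in> ?pN then \<bar>F (Sup (snd i)) - F (Inf (snd i))\<bar> else 0))"
      proof (rule order_trans[OF sum_abs], rule sum_mono)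
        fix i assume "i \<in> p"
        then obtain x K' where i: "i = (x, K')" "(x, K') \<in> p" by (metis surj_pair)
        have cont: "measure lborel K' = Sup K' - Inf K'"
          using arg_cong[OF K(1)[OF i(2)], of "measure lborel"] K(2,3)[OF i(2)] by simp
        have nn: "0 \<le> e / 2 * (Sup K' - Inf K')"
          using K(2,3)[OF i(2)] \<open>0 < e\<close> by simp
        show "\<bar>case i of (x, K) \<Rightarrow> measure lborel K * f' x - (F (Sup K) - F (Inf K))\<bar>
          \<le> e / 2 * (Sup (snd i) - Inf (snd i))
          + (if i \<in> ?pN then \<bar>F (Sup (snd i)) - F (Inf (snd i))\<bar> else 0)"
        proof (cases "x \<in> N")
          case True
          then show ?thesis using i nn by (simp add: f'_def)
        next
          case False
          have "x \<in> {a..b} - N" using K(2-5)[OF i(2)] False by auto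
          from d(3)[OF this K(4,5,2,3,6,7)[OF i(2)]]
          show ?thesis using False i by (simp add: f'_def cont)
        qed
      qed
      also have "\<dots> = e / 2 * (\<Sum>i\<in>p. Sup (snd i) - Inf (snd i))
          + (\<Sum>i\<in>?pN. \<bar>F (Sup (snd i)) - F (Inf (snd i))\<bar>)"
      proof -
        have "(\<Sum>i\<in>p. if i \<in> ?pN then \<bar>F (Sup (snd i)) - F (Inf (snd i))\<bar> else 0)
            = (\<Sum>i\<in>p \<inter> ?pN. \<bar>F (Sup (snd i)) - F (Inf (snd i))\<bar>)"
          by (rule sum.inter_restrict[OF fin, symmetric])
        also have "p \<inter> ?pN = ?pN" by auto
        finally show ?thesis by (simp only: sum.distrib sum_distrib_left)
      qed
      also have "(\<Sum>i\<in>p. Sup (snd i) - Inf (snd i)) = b - a"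
        using additive_tagged_division_1[OF ab tag', of "\<lambda>x. x"] by (simp add: case_prod_beta)
      finally show "norm ((\<Sum>(x, K)\<in>p. measure lborel K *\<^sub>R f' x) - (F b - F a)) \<le> e * measure lborel (cbox a b)"
        using sumN ab by (simp add: field_simps)
    qed
  qed
  then show ?thesis
    by (rule has_integral_spike[of N, rotated 2])
      (use N(1) in \<open>auto simp: f'_def negligible_iff_null_sets\<close>)
qed (use has_integral_refl in auto)

text \<open>On an interval shorter than the \<open>\<delta>\<close> belonging to
  \<open>\<epsilon> = 1\<close>, the integrals of \<open>f\<close> over the pieces of any division
  are increments of \<open>F\<close>, and their moduli sum to less than \<open>1\<close>. This
  bounded variation gives absolute integrability there, and finitely many such intervals are
  joined.\<close>

lemma absolutely_continuous_absolutely_integrable: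
  assumes ab: "a \<le> b" and ac: "absolutely_continuous_fun_on a b F"
    and der: "AE t in lebesgue. t \<in> {a..b} \<longrightarrow> (F has_real_derivative f t) (at t within {a..b})"
  shows "f absolutely_integrable_on {a..b}"
proof -
  have sub: "(f has_integral F d - F c) {c..d}" if "a \<le> c" "c \<le> d" "d \<le> b" for c d
  proof (rule absolutely_continuous_has_integral)
    show "absolutely_continuous_fun_on c d F"
      by (rule absolutely_continuous_fun_on_subset[OF ac that(1,3)])
    show "AE t in lebesgue. t \<in> {c..d} \<longrightarrow> (F has_real_derivative f t) (at t within {c..d})"
      using der by eventually_elim (use that in \<open>auto intro: has_field_derivative_subset\<close>)
  qed (rule that)
  obtain \<delta> where \<delta>: "0 < \<delta>" "small_increments a b F \<delta> 1"
    by (rule absolutely_continuous_fun_onD[OF ac zero_less_one]) blast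
  have small: "f absolutely_integrable_on {c..d}" if cd: "a \<le> c" "c \<le> d" "d \<le> b" "d - c < \<delta>" for c d
    unfolding box_real(2)[symmetric]
  proof (rule bounded_variation_absolutely_integrable_interval[where B = 1])
    show "f integrable_on cbox c d" using sub[OF cd(1-3)] by auto
    fix D assume D: "D division_of cbox c d"
    have fin: "finite D" using D by blast
    have K: "K = {Inf K..Sup K}" "Inf K \<le> Sup K" "Inf K \<in> {c..d}" "Sup K \<in> {c..d}" if KD: "K \<in> D" for K
    proof -
      obtain u v where uv: "K = cbox u v" using division_ofD(4)[OF D KD] by blast
      have le: "u \<le> v" using division_ofD(3)[OF D KD] uv by auto
      then have IS: "Inf K = u" "Sup K = v" using uv by auto
      have "u \<in> K" "v \<in> K" using le uv by auto
      then have "u \<in> {c..d}" "v \<in> {c..d}" using division_ofD(2)[OF D KD] by auto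
      then show "K = {Inf K..Sup K}" "Inf K \<le> Sup K" "Inf K \<in> {c..d}" "Sup K \<in> {c..d}"
        unfolding IS using uv le by auto
    qed
    have disj: "disjoint_family_on (\<lambda>K. {Inf K<..<Sup K}) D"
      unfolding disjoint_family_on_def
    proof (intro ballI impI)
      fix K1 K2 assume K12: "K1 \<in> D" "K2 \<in> D" "K1 \<noteq> K2"
      show "{Inf K1<..<Sup K1} \<inter> {Inf K2<..<Sup K2} = {}"
        using division_ofD(5)[OF D K12] arg_cong[OF K(1)[OF K12(1)], of interior]
          arg_cong[OF K(1)[OF K12(2)], of interior] by simp
    qed
    have "ennreal (\<Sum>K\<in>D. Sup K - Inf K) \<le> emeasure lebesgue {c..d}"
      proof (rule sum_lengths_le_measure[OF fin _ disj])
      fix K' assume "K' \<in> D"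
      from K[OF this] show "Inf K' \<le> Sup K'" "{Inf K'<..<Sup K'} \<subseteq> {c..d}" by auto
    qed auto
    then have "(\<Sum>K\<in>D. Sup K - Inf K) < \<delta>"
      using cd by simp
    then have "(\<Sum>K\<in>D. \<bar>F (Sup K) - F (Inf K)\<bar>) < 1"
    proof (rule small_incrementsD[OF \<delta>(2) fin _ disj, rotated])
      fix K' assume "K' \<in> D"
      from K(2-4)[OF this] show "a \<le> Inf K' \<and> Inf K' \<le> Sup K' \<and> Sup K' \<le> b"
        using cd by auto
    qed
    moreover have "integral K f = F (Sup K) - F (Inf K)" if "K \<in> D" for K
    proof -
      have "(f has_integral F (Sup K) - F (Inf K)) {Inf K..Sup K}"
        using K[OF that] cd by (intro sub) auto
      then show ?thesis unfolding K(1)[OF that, symmetric] by (rule integral_unique)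
    qed
    ultimately show "(\<Sum>K\<in>D. norm (integral K f)) \<le> 1" by simp
  qed
  obtain n :: nat where n: "(b - a) / \<delta> < real n" using reals_Archimedean2 by blast
  have n0: "0 < n" using n ab \<delta>(1) by (cases n) (auto simp: divide_less_0_iff)
  have step: "(b - a) / real n < \<delta>" using n n0 \<delta>(1) by (simp add: field_simps)
  define w where "w = (b - a) / real n"
  have w: "0 \<le> w" "w < \<delta>" "real n * w = b - a" using ab n0 step by (auto simp: w_def)
  define s where "s k = a + real k * w" for k
  have s_0: "s 0 = a" and s_n: "s n = b" using w(3) by (auto simp: s_def)
  have s_Suc: "s (Suc k) = s k + w" for k by (simp add: s_def distrib_right)
  have s_ge: "a \<le> s k" for k using w(1) by (simp add: s_def)
  have s_le: "s k \<le> b" if "k \<le> n" for k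
    using mult_right_mono[OF of_nat_mono[OF that] w(1)] w(3) unfolding s_def by linarith
  have "f absolutely_integrable_on {a..s k}" if "k \<le> n" for k
    using that
  proof (induction k)
    case 0
    have "f absolutely_integrable_on {a..a}" by (rule small) (use ab \<delta>(1) in simp_all)
    then show ?case by (simp only: s_0)
  next
    case (Suc k)
    have le: "s k \<le> s (Suc k)" and lt: "s (Suc k) - s k < \<delta>"
      unfolding s_Suc using w by simp_all
    show ?case
      by (rule absolutely_integrable_on_combine[OF Suc.IH[OF Suc_leD[OF Suc.prems]]
            small[OF s_ge le s_le[OF Suc.prems] lt] s_ge le])
  qed
  from this[of n] show ?thesis by (simp add: s_n)
qed

section \<open>Powers of the distance and the derivative of the fBm covariance\<close>

text \<open>The second, odd function is recorded because for \<open>0 < p\<close> it is a primitive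
  of the modulus of the derivative in the first claim.\<close>

lemma abs_powr_derivative:
  fixes s t p :: real
  assumes "t \<noteq> s"
  shows "((\<lambda>t. \<bar>t - s\<bar> powr p) has_real_derivative p * sgn (t - s) * \<bar>t - s\<bar> powr (p - 1)) (at t)"
    and "((\<lambda>t. sgn (t - s) * \<bar>t - s\<bar> powr p) has_real_derivative p * \<bar>t - s\<bar> powr (p - 1)) (at t)"
proof -
  consider "s < t" | "t < s" using assms by linarith
  then have "((\<lambda>t. \<bar>t - s\<bar> powr p) has_real_derivative p * sgn (t - s) * \<bar>t - s\<bar> powr (p - 1)) (at t) \<and>
    ((\<lambda>t. sgn (t - s) * \<bar>t - s\<bar> powr p) has_real_derivative p * \<bar>t - s\<bar> powr (p - 1)) (at t)"
  proof cases
    case 1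
    have "((\<lambda>t. t - s) has_real_derivative 1) (at t)"
      by (rule DERIV_cong[OF DERIV_diff[OF DERIV_ident DERIV_const]]) simp
    from DERIV_fun_powr[OF this, of p] 1
    have "((\<lambda>t. (t - s) powr p) has_real_derivative p * \<bar>t - s\<bar> powr (p - 1)) (at t)"
      by simp
    then have "((\<lambda>t. \<bar>t - s\<bar> powr p) has_real_derivative p * \<bar>t - s\<bar> powr (p - 1)) (at t)"
      "((\<lambda>t. sgn (t - s) * \<bar>t - s\<bar> powr p) has_real_derivative p * \<bar>t - s\<bar> powr (p - 1)) (at t)"
      by (rule has_field_derivative_transform_within_open[where S = "{s<..}"]; use 1 in simp)+
    then show ?thesis using 1 by simp
  next
    case 2
    have "((\<lambda>t. s - t) has_real_derivative - 1) (at t)"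
      by (rule DERIV_cong[OF DERIV_diff[OF DERIV_const DERIV_ident]]) simp
    from DERIV_fun_powr[OF this, of p] 2
    have d: "((\<lambda>t. (s - t) powr p) has_real_derivative - (p * \<bar>t - s\<bar> powr (p - 1))) (at t)"
      by simp
    have "((\<lambda>t. \<bar>t - s\<bar> powr p) has_real_derivative - (p * \<bar>t - s\<bar> powr (p - 1))) (at t)"
      by (rule has_field_derivative_transform_within_open[OF d, where S = "{..<s}"]; use 2 in simp)
    moreover have "((\<lambda>t. sgn (t - s) * \<bar>t - s\<bar> powr p) has_real_derivative
        - (- (p * \<bar>t - s\<bar> powr (p - 1)))) (at t)"
      by (rule has_field_derivative_transform_within_open[OF DERIV_minus[OF d], where S = "{..<s}"]; use 2 in simp)
    ultimately show ?thesis using 2 by simp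
  qed
  then show "((\<lambda>t. \<bar>t - s\<bar> powr p) has_real_derivative p * sgn (t - s) * \<bar>t - s\<bar> powr (p - 1)) (at t)"
    "((\<lambda>t. sgn (t - s) * \<bar>t - s\<bar> powr p) has_real_derivative p * \<bar>t - s\<bar> powr (p - 1)) (at t)" by auto
qed

text \<open>Only \<open>t = s\<close> is critical. A positive exponent makes the first function tend
  to \<open>0\<close> there, and it dominates the second.\<close>

lemma continuous_on_abs_powr:
  fixes s p :: real
  assumes "0 < p"
  shows "continuous_on A (\<lambda>t. \<bar>t - s\<bar> powr p)" "continuous_on A (\<lambda>t. sgn (t - s) * \<bar>t - s\<bar> powr p)"
proof -
  have c: "continuous_on UNIV (\<lambda>t. \<bar>t - s\<bar> powr p)"
    by (rule continuous_on_powr') (use assms in \<open>auto intro!: continuous_intros\<close>)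
  then show "continuous_on A (\<lambda>t. \<bar>t - s\<bar> powr p)" by (rule continuous_on_subset) simp
  have "isCont (\<lambda>t. sgn (t - s) * \<bar>t - s\<bar> powr p) t" for t
  proof (cases "t = s")
    case True
    have "isCont (\<lambda>t. \<bar>t - s\<bar> powr p) s"
      using c by (simp add: continuous_on_eq_continuous_at)
    then have lim: "((\<lambda>t. \<bar>t - s\<bar> powr p) \<longlongrightarrow> 0) (at s)"
      unfolding isCont_def by simp
    have "((\<lambda>t. sgn (t - s) * \<bar>t - s\<bar> powr p) \<longlongrightarrow> 0) (at s)"
    proof (rule Lim_null_comparison[OF _ lim], rule always_eventually, rule allI)
      show "norm (sgn (t - s) * \<bar>t - s\<bar> powr p) \<le> \<bar>t - s\<bar> powr p" for t
        by (simp add: abs_mult sgn_if)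
    qed
    then show ?thesis unfolding True isCont_def by simp
  next
    case False
    then show ?thesis by (rule DERIV_isCont[OF abs_powr_derivative(2)])
  qed
  then show "continuous_on A (\<lambda>t. sgn (t - s) * \<bar>t - s\<bar> powr p)"
    by (intro continuous_at_imp_continuous_on) auto
qed

text \<open>For \<open>p < 1\<close> the integrand is unbounded near \<open>s\<close>. The
  fundamental theorem with the exceptional point \<open>s\<close> asks there only for continuity of
  the primitive; applied to the odd power it shows that the modulus is integrable as well.\<close>

lemma abs_powr_integral:
  fixes s p a b :: real
  assumes "0 < p" "a \<le> b"
  shows "((\<lambda>t. p * sgn (t - s) * \<bar>t - s\<bar> powr (p - 1)) has_integral \<bar>b - s\<bar> powr p - \<bar>a - s\<bar> powr p) {a..b}"
    and "(\<lambda>t. p * sgn (t - s) * \<bar>t - s\<bar> powr (p - 1)) absolutely_integrable_on {a..b}"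
proof -
  show 1: "((\<lambda>t. p * sgn (t - s) * \<bar>t - s\<bar> powr (p - 1)) has_integral \<bar>b - s\<bar> powr p - \<bar>a - s\<bar> powr p) {a..b}"
    using assms abs_powr_derivative(1)[of _ s p] continuous_on_abs_powr(1)[of p "{a..b}" s]
    by (intro fundamental_theorem_of_calculus_interior_strong[where S = "{s}"])
      (auto simp: has_real_derivative_iff_has_vector_derivative)
  have "((\<lambda>t. p * \<bar>t - s\<bar> powr (p - 1)) has_integral
      sgn (b - s) * \<bar>b - s\<bar> powr p - sgn (a - s) * \<bar>a - s\<bar> powr p) {a..b}"
    using assms abs_powr_derivative(2)[of _ s p] continuous_on_abs_powr(2)[of p "{a..b}" s]
    by (intro fundamental_theorem_of_calculus_interior_strong[where S = "{s}"])
      (auto simp: has_real_derivative_iff_has_vector_derivative)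
  then have "(\<lambda>t. norm (p * sgn (t - s) * \<bar>t - s\<bar> powr (p - 1))) integrable_on {a..b}"
    by (rule integrable_eq[OF has_integral_integrable]) (use assms in \<open>auto simp: abs_mult sgn_if\<close>)
  with 1 show "(\<lambda>t. p * sgn (t - s) * \<bar>t - s\<bar> powr (p - 1)) absolutely_integrable_on {a..b}"
    by (intro absolutely_integrable_onI) auto
qed

text \<open>Absolute continuity is given for \<open>R\<close> only. The derivative \<open>E\<close>
  of the fBm covariance is explicit and absolutely integrable, so the results above are applied to
  \<open>d + E\<close>, which is the derivative of \<open>R\<close> almost everywhere, and
  \<open>E\<close> is subtracted.\<close>

lemma derivative_difference_integral:
  assumes "0 < T" "0 < H" and s: "0 \<le> s"
    and ac: "absolutely_continuous_fun_on 0 T R"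
    and der: "AE t in lebesgue. t \<in> {0..T} \<longrightarrow>
     (\<exists>r r'. (R has_real_derivative r) (at t within {0..T})
           \<and> (fbm_cov H s has_real_derivative r') (at t within {0..T}) \<and> d t = r - r')"
  shows "d absolutely_integrable_on {0..T}"
    and "0 \<le> a \<Longrightarrow> a \<le> b \<Longrightarrow> b \<le> T \<Longrightarrow>
      (d has_integral (R b - fbm_cov H s b) - (R a - fbm_cov H s a)) {a..b}"
proof -
  define E where "E t = (2 * H * sgn (t - 0) * \<bar>t - 0\<bar> powr (2 * H - 1)
    - 2 * H * sgn (t - s) * \<bar>t - s\<bar> powr (2 * H - 1)) / 2" for t
  have E: "(E has_integral (\<bar>b - 0\<bar> powr (2 * H) - \<bar>a - 0\<bar> powr (2 * H)
      - (\<bar>b - s\<bar> powr (2 * H) - \<bar>a - s\<bar> powr (2 * H))) / 2) {a..b}" if "a \<le> b" for a b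
    unfolding E_def using assms(2) that by (intro has_integral_divide has_integral_diff abs_powr_integral) auto
  have E_abs: "E absolutely_integrable_on {a..b}" if "a \<le> b" for a b
    unfolding E_def using assms(2) that
    by (intro set_integrable_divide set_integral_diff(1) abs_powr_integral(2)) auto
  \<comment> \<open>The end points are discarded to make the derivatives two-sided, and
    \<open>0\<close> and \<open>s\<close> because the powers need not be differentiable
    there.\<close>
  have ne: "AE t in lebesgue. t \<noteq> c" for c :: real
    by (rule AE_completion) (rule AE_lborel_singleton)
  have der': "AE t in lebesgue. t \<in> {0..T} \<longrightarrow> (R has_real_derivative d t + E t) (at t within {0..T})"
    using der ne[of 0] ne[of T] ne[of s]
  proof eventually_elim
    case (elim t)
    show ?case
    proof
      assume t: "t \<in> {0..T}"
      then obtain r r' where r: "(R has_real_derivative r) (at t within {0..T})"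
        "(fbm_cov H s has_real_derivative r') (at t within {0..T})" "d t = r - r'"
        using elim by blast
      have at: "at t within {0..T} = at t" using t elim by (intro at_within_Icc_at) auto
      \<comment> \<open>In \<open>fbm_cov\<close> the power of \<open>t\<close> carries no modulus;
        it agrees with the function differentiated here on the open half-line
        \<open>{0<..}\<close>.\<close>
      have "((\<lambda>t. (s powr (2 * H) + \<bar>t - 0\<bar> powr (2 * H) - \<bar>t - s\<bar> powr (2 * H)) / 2)
          has_real_derivative (0 + 2 * H * sgn (t - 0) * \<bar>t - 0\<bar> powr (2 * H - 1)
            - 2 * H * sgn (t - s) * \<bar>t - s\<bar> powr (2 * H - 1)) / 2) (at t)"
        using elim by (intro DERIV_cdivide DERIV_diff DERIV_add DERIV_const abs_powr_derivative) auto
      then have "(fbm_cov H s has_real_derivative E t) (at t)"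
        by (rule has_field_derivative_transform_within_open[where S = "{0<..}", THEN DERIV_cong])
          (use t elim in \<open>auto simp: fbm_cov_def E_def\<close>)
      then have "r' = E t" using r(2) unfolding at by (rule DERIV_unique[rotated])
      then show "(R has_real_derivative d t + E t) (at t within {0..T})" using r by simp
    qed
  qed
  have "(\<lambda>t. (d t + E t) - E t) absolutely_integrable_on {0..T}"
    by (intro set_integral_diff(1) absolutely_continuous_absolutely_integrable[OF _ ac der'] E_abs)
      (use assms in auto)
  then show "d absolutely_integrable_on {0..T}" by simp
  assume ab: "0 \<le> a" "a \<le> b" "b \<le> T"
  have "((\<lambda>t. d t + E t) has_integral R b - R a) {a..b}"
  proof (rule absolutely_continuous_has_integral[OF ab(2)])
    show "absolutely_continuous_fun_on a b R"
      by (rule absolutely_continuous_fun_on_subset[OF ac ab(1,3)])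
    show "AE t in lebesgue. t \<in> {a..b} \<longrightarrow> (R has_real_derivative d t + E t) (at t within {a..b})"
      using der' by eventually_elim (use ab in \<open>auto intro: has_field_derivative_subset\<close>)
  qed
  from has_integral_diff[OF this E[OF ab(2)]]
  show "(d has_integral (R b - fbm_cov H s b) - (R a - fbm_cov H s a)) {a..b}"
    by (rule has_integral_eq_rhs[OF has_integral_eq[rotated]])
      (use ab in \<open>auto simp: fbm_cov_def field_simps\<close>)
qed

section \<open>The covariance difference\<close>

lemma grid_step_comp:
  assumes "0 < T" "\<phi> 0 = 0"
  shows "grid_step T n (\<lambda>i. \<phi> (c i)) x = \<phi> (grid_step T n c x)"
proof (cases "0 < n \<and> x \<in> {0<..T}")
  case True
  then obtain i where i: "i < n" "x \<in> {grid T n i<..grid T n (Suc i)}"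
    using grid_cellE[OF assms(1), of n x] by blast
  show ?thesis by (simp add: grid_step_eq[OF assms(1) i])
next
  case False
  then have "grid_step T n d x = 0" for d
    using grid_step_outside[OF assms(1), of x] by (cases "n = 0") (auto simp: grid_step_def)
  then show ?thesis by (simp add: assms(2))
qed

text \<open>Here \<open>h\<close> need not be measurable: its \<open>nn_integral\<close> is a lower integral, which still
  dominates the one of the measurable supremum of the sequence.\<close>

lemma dominated_by_lower_integral:
  fixes F :: "nat \<Rightarrow> 'a \<Rightarrow> real"
  assumes meas [measurable]: "\<And>n. F n \<in> borel_measurable M"
    and le: "\<And>n x. ennreal \<bar>F n x\<bar> \<le> h x" and fin: "(\<integral>\<^sup>+x. h x \<partial>M) < \<infinity>"
    and lim: "\<And>x. (\<lambda>n. F n x) \<longlonglongrightarrow> L x"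
  shows "(\<lambda>n. LINT x|M. F n x) \<longlonglongrightarrow> (LINT x|M. L x)"
proof -
  define S where "S x = (SUP n. ennreal \<bar>F n x\<bar>)" for x
  have [measurable]: "S \<in> borel_measurable M" unfolding S_def by measurable
  have S_le: "S x \<le> h x" for x unfolding S_def by (intro SUP_least le)
  have "(\<integral>\<^sup>+x. S x \<partial>M) \<le> (\<integral>\<^sup>+x. h x \<partial>M)" by (intro nn_integral_mono S_le)
  with fin have S_fin: "(\<integral>\<^sup>+x. S x \<partial>M) < \<infinity>" by simp
  then have "AE x in M. S x \<noteq> \<infinity>" by (intro nn_integral_PInf_AE) auto
  show ?thesis
  proof (rule integral_dominated_convergence[where w = "\<lambda>x. enn2real (S x)"])
    show "L \<in> borel_measurable M"
      by (rule borel_measurable_LIMSEQ_metric[OF meas lim])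
    show "integrable M (\<lambda>x. enn2real (S x))"
    proof (rule integrableI_bounded)
      have "(\<integral>\<^sup>+x. ennreal (norm (enn2real (S x))) \<partial>M) \<le> (\<integral>\<^sup>+x. S x \<partial>M)"
        by (intro nn_integral_mono) (simp add: ennreal_enn2real_if)
      with S_fin show "(\<integral>\<^sup>+x. ennreal (norm (enn2real (S x))) \<partial>M) < \<infinity>" by simp
    qed simp
    show "AE x in M. norm (F n x) \<le> enn2real (S x)" for n
      using \<open>AE x in M. S x \<noteq> \<infinity>\<close>
    proof eventually_elim
      case (elim x)
      have "ennreal \<bar>F n x\<bar> \<le> S x" unfolding S_def by (rule SUP_upper) simp
      also have "S x = ennreal (enn2real (S x))" using elim by (simp add: less_top)
      finally show ?case by simp
    qed
  qed (use lim in auto)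
qed

lemma nu_integral_cong:
  "(\<And>x. x \<in> {0..T} \<Longrightarrow> \<phi> x = \<phi>' x) \<Longrightarrow> nu_integral T f \<phi> = nu_integral T f \<phi>'"
  unfolding nu_integral_def ls_integral_def ls_pos_def ls_neg_def
  by (intro arg_cong2[where f = "(-)"] set_lebesgue_integral_cong) auto

text \<open>Linearity is read off from the Riemann sums, which are linear in the integrand, and from
  uniqueness of limits.\<close>

lemma nu_integral_diff:
  assumes "0 < T" "g \<in> bv_functions T"
    and "continuous_on {0..T} \<phi>" "\<phi> 0 = 0" "continuous_on {0..T} \<psi>" "\<psi> 0 = 0"
  shows "nu_integral T g (\<lambda>x. \<phi> x - \<psi> x) = nu_integral T g \<phi> - nu_integral T g \<psi>"
proof -
  let ?S = "\<lambda>h n. \<Sum>i<n. cell_values T g n i * (h (grid T n (Suc i)) - h (grid T n i))"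
  have diff: "?S (\<lambda>x. \<phi> x - \<psi> x) \<longlonglongrightarrow> - nu_integral T g (\<lambda>x. \<phi> x - \<psi> x)"
    by (rule nu_integral_tendsto[OF assms(1,2)]) (use assms in \<open>auto intro: continuous_on_diff\<close>)
  have "?S (\<lambda>x. \<phi> x - \<psi> x) = (\<lambda>n. ?S \<phi> n - ?S \<psi> n)"
    unfolding sum_subtractf[symmetric] by (intro ext sum.cong refl) (simp add: right_diff_distrib)
  moreover have "(\<lambda>n. ?S \<phi> n - ?S \<psi> n) \<longlonglongrightarrow> - nu_integral T g \<phi> - - nu_integral T g \<psi>"
    by (intro tendsto_diff nu_integral_tendsto assms)
  ultimately have "?S (\<lambda>x. \<phi> x - \<psi> x) \<longlonglongrightarrow> - nu_integral T g \<phi> - - nu_integral T g \<psi>"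
    by (simp only:)
  from LIMSEQ_unique[OF diff this] show ?thesis by simp
qed

lemma continuous_sections:
  assumes "continuous_on (A \<times> A) (\<lambda>(s, t). k s t)" "x \<in> A"
  shows "continuous_on A (k x)" "continuous_on A (\<lambda>s. k s x)"
proof -
  have "continuous_on A (\<lambda>t. case (x, t) of (s, t) \<Rightarrow> k s t)"
    by (rule continuous_on_compose2[OF assms(1)])
      (use assms(2) in \<open>auto intro!: continuous_on_Pair continuous_on_const continuous_on_id\<close>)
  then show "continuous_on A (k x)" by simp
  have "continuous_on A (\<lambda>s. case (s, x) of (s, t) \<Rightarrow> k s t)"
    by (rule continuous_on_compose2[OF assms(1)])
      (use assms(2) in \<open>auto intro!: continuous_on_Pair continuous_on_const continuous_on_id\<close>)
  then show "continuous_on A (\<lambda>s. k s x)" by simp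
qed

text \<open>The kernel is bounded on the compact square and converges at every \<open>t\<close>, so
  bounded convergence applies with an empty exceptional set.\<close>

lemma continuous_on_nu_integral:
  assumes f: "f \<in> bv_functions T"
    and cont: "continuous_on ({0..T} \<times> {0..T}) (\<lambda>(s, t). k s t)"
  shows "continuous_on {0..T} (\<lambda>s. nu_integral T f (k s))"
  unfolding continuous_on_sequentially
proof (intro allI impI ballI, elim conjE)
  fix x and s :: real assume s: "s \<in> {0..T}" and x: "\<forall>n. x n \<in> {0..T}" "x \<longlonglongrightarrow> s"
  have "bounded ((\<lambda>(s, t). k s t) ` ({0..T} \<times> {0..T}))"
    by (intro compact_imp_bounded compact_continuous_image[OF cont] compact_Times compact_Icc)
  then obtain C where "\<forall>y\<in>(\<lambda>(s, t). k s t) ` ({0..T} \<times> {0..T}). norm y \<le> C"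
    unfolding bounded_iff by blast
  then have C: "\<bar>k s t\<bar> \<le> C" if "s \<in> {0..T}" "t \<in> {0..T}" for s t
    using that by (force dest: bspec[of _ _ "k s t"])
  note cont_k = continuous_sections(1)[OF cont]
  have meas: "(\<lambda>t. indicator {0..T} t * k s t) \<in> borel_measurable borel" if "s \<in> {0..T}" for s
    using borel_measurable_continuous_on_indicator[OF _ cont_k[OF that]] by simp
  show "((\<lambda>s. nu_integral T f (k s)) \<circ> x) \<longlonglongrightarrow> nu_integral T f (k s)"
    unfolding nu_integral_def comp_def
  proof (rule ls_integral_bounded_convergence[OF zero_extension_bv[OF f], where N = "{}" and C = C])
    fix t assume t: "t \<in> {0..T} - {}"
    have "continuous_on {0..T} (\<lambda>s. k s t)"
      using t by (intro continuous_sections(2)[OF cont]) simp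
    then show "(\<lambda>n. k (x n) t) \<longlonglongrightarrow> k s t"
      using s x unfolding continuous_on_sequentially comp_def by blast
  qed (use meas C s x in auto)
qed

section \<open>One fixed \<open>s\<close>: the density \<open>d = D s\<close> and its primitive
  \<open>k\<close>\<close>

context
  fixes T :: real and d k :: "real \<Rightarrow> real"
  assumes T: "0 < T"
    and d: "d absolutely_integrable_on {0..T}"
    and k: "\<And>a b. 0 \<le> a \<Longrightarrow> a \<le> b \<Longrightarrow> b \<le> T \<Longrightarrow> (d has_integral k b - k a) {a..b}"
begin

lemma integral_grid_step_mult:
  "(LINT u:{0..T}|lebesgue. grid_step T n c u * d u)
    = (\<Sum>i<n. c i * (k (grid T n (Suc i)) - k (grid T n i)))"
proof -
  let ?I = "\<lambda>i. {grid T n i<..grid T n (Suc i)}"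
  have sub: "?I i \<subseteq> {0..T}" if "i < n" for i using grid_cell_subset[OF T that] by auto
  have int: "set_integrable lebesgue (?I i) d" if "i < n" for i
    by (rule set_integrable_subset[OF d _ sub[OF that]]) auto
  have val: "(LINT u:?I i|lebesgue. d u) = k (grid T n (Suc i)) - k (grid T n i)" if "i < n" for i
  proof -
    let ?J = "{grid T n i..grid T n (Suc i)}"
    have "(d has_integral k (grid T n (Suc i)) - k (grid T n i)) ?J"
      using grid_mem[OF T, of i n] grid_mem[OF T, of "Suc i" n] grid_mono[OF T, of i "Suc i" n] that
      by (intro k) auto
    \<comment> \<open>The primitive gives the integral over the closed cell, which differs from the
      half-open one by a single point.\<close>
    moreover have "negligible {x \<in> ?J - ?I i. d x \<noteq> 0}" "negligible {x \<in> ?I i - ?J. d x \<noteq> 0}"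
      by (rule negligible_subset[of "{grid T n i}"]; force)+
    ultimately have "(d has_integral k (grid T n (Suc i)) - k (grid T n i)) (?I i)"
      using has_integral_spike_set_eq by blast
    then show ?thesis using set_lebesgue_integral_eq_integral(2)[OF int[OF that]] by (simp add: integral_unique)
  qed
  have "(LINT u:{0..T}|lebesgue. grid_step T n c u * d u)
      = (LINT u|lebesgue. (\<Sum>i<n. c i * (indicator (?I i) u *\<^sub>R d u)))"
    unfolding set_lebesgue_integral_def
  proof (rule Bochner_Integration.integral_cong[OF refl])
    fix u
    have "grid_step T n c u * d u = (\<Sum>i<n. c i * (indicator (?I i) u *\<^sub>R d u))"
      unfolding grid_step_def sum_distrib_right by (rule sum.cong) auto
    then show "indicator {0..T} u *\<^sub>R (grid_step T n c u * d u) = (\<Sum>i<n. c i * (indicator (?I i) u *\<^sub>R d u))"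
      using grid_step_outside[OF T, of u n c] by (cases "u \<in> {0<..T}") auto
  qed
  also have "\<dots> = (\<Sum>i<n. LINT u|lebesgue. c i * (indicator (?I i) u *\<^sub>R d u))"
    using int by (intro Bochner_Integration.integral_sum integrable_mult_right) (auto simp: set_integrable_def)
  also have "\<dots> = (\<Sum>i<n. c i * (k (grid T n (Suc i)) - k (grid T n i)))"
    using val by (intro sum.cong) (auto simp: set_lebesgue_integral_def)
  finally show ?thesis .
qed

lemma set_integrable_bv_mult:
  assumes f: "f \<in> bv_functions T"
  shows "set_integrable lebesgue {0..T} (\<lambda>u. f u * d u)"
proof -
  obtain C where C: "0 \<le> C" "\<And>x. x \<in> {0..T} \<Longrightarrow> \<bar>f x\<bar> \<le> C" using bv_functions_bounded[OF f] by blast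
  have m: "zero_extension T f \<in> borel_measurable lebesgue"
    using bv_functions_borel_measurable[OF f] by (intro measurable_completion) simp
  have int: "integrable lebesgue (\<lambda>u. C * (indicator {0..T} u *\<^sub>R d u))"
    using d by (intro integrable_mult_right) (simp add: set_integrable_def)
  have "integrable lebesgue (\<lambda>u. zero_extension T f u * (indicator {0..T} u *\<^sub>R d u))"
  proof (rule Bochner_Integration.integrable_bound[OF int])
    show "(\<lambda>u. zero_extension T f u * (indicator {0..T} u *\<^sub>R d u)) \<in> borel_measurable lebesgue"
      using m d by (intro borel_measurable_times) (auto simp: set_integrable_def dest: borel_measurable_integrable)
    show "AE u in lebesgue. norm (zero_extension T f u * (indicator {0..T} u *\<^sub>R d u))
        \<le> norm (C * (indicator {0..T} u *\<^sub>R d u))"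
      using C by (intro AE_I2) (auto simp: zero_extension_def abs_mult indicator_def intro!: mult_right_mono)
  qed
  then show ?thesis
    unfolding set_integrable_def
    by (rule Bochner_Integration.integrable_cong[THEN iffD1, rotated 2]) (auto simp: zero_extension_def indicator_def)
qed

text \<open>The Riemann sums of \<open>nu_integral_tendsto\<close> are the integrals of
  \<open>d\<close> times the step functions with the cell values of \<open>f\<close>. These steps
  are dominated by the modulus of \<open>f\<close> and converge to \<open>f\<close> off a countable
  set, so the same sums also tend to the Lebesgue integral of \<open>f u * d u\<close>.\<close>

lemma nu_integral_eq_integral:
  assumes f: "f \<in> bv_functions T" and cont: "continuous_on {0..T} k" and zero: "k 0 = 0"
  shows "nu_integral T f k = - (LINT u:{0..T}|lebesgue. f u * d u)"
proof -
  let ?c = "cell_values T f"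
  have "(\<lambda>n. LINT u:{0..T}|lebesgue. grid_step T n (?c n) u * d u) \<longlonglongrightarrow> (LINT u:{0..T}|lebesgue. f u * d u)"
    unfolding set_lebesgue_integral_def
  proof (rule integral_dominated_convergence[where w = "\<lambda>u. norm (indicator {0..T} u *\<^sub>R (f u * d u))"])
    have int: "integrable lebesgue (\<lambda>u. indicator {0..T} u *\<^sub>R (f u * d u))"
      using set_integrable_bv_mult[OF f] by (simp add: set_integrable_def)
    show "(\<lambda>u. indicator {0..T} u *\<^sub>R (f u * d u)) \<in> borel_measurable lebesgue"
      using int by (rule borel_measurable_integrable)
    show "integrable lebesgue (\<lambda>u. norm (indicator {0..T} u *\<^sub>R (f u * d u)))"
      using int by (rule integrable_norm)
    have m: "(\<lambda>u. indicator {0..T} u *\<^sub>R d u) \<in> borel_measurable lebesgue"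
      using d by (auto simp: set_integrable_def dest: borel_measurable_integrable)
    show "(\<lambda>u. indicator {0..T} u *\<^sub>R (grid_step T n (?c n) u * d u)) \<in> borel_measurable lebesgue" for n
    proof -
      have "grid_step T n (?c n) \<in> borel_measurable lebesgue"
        by (intro measurable_completion) simp
      from borel_measurable_times[OF this m] show ?thesis by (simp add: mult.left_commute)
    qed
    show "AE u in lebesgue. norm (indicator {0..T} u *\<^sub>R (grid_step T n (?c n) u * d u))
        \<le> norm (indicator {0..T} u *\<^sub>R (f u * d u))" for n
      using abs_cell_values_le[OF T f]
      by (intro AE_I2) (auto simp: indicator_def abs_mult intro!: mult_right_mono)
    \<comment> \<open>The point \<open>0\<close> is included because every grid step function
      vanishes there.\<close>
    let ?N = "insert 0 {x \<in> {0..T}. \<not> continuous (at x within {0..T}) f}"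
    have "countable ?N" using bv_functions_countable_discontinuities[OF f] by simp
    then have null: "?N \<in> null_sets lebesgue"
      by (intro null_sets_completionI countable_imp_null_set_lborel)
    show "AE u in lebesgue. (\<lambda>n. indicator {0..T} u *\<^sub>R (grid_step T n (?c n) u * d u))
        \<longlonglongrightarrow> indicator {0..T} u *\<^sub>R (f u * d u)"
    proof (rule AE_I'[OF null], rule subsetI, rule ccontr)
      fix u assume u: "u \<in> {u \<in> space lebesgue. \<not> (\<lambda>n. indicator {0..T} u *\<^sub>R (grid_step T n (?c n) u * d u))
        \<longlonglongrightarrow> indicator {0..T} u *\<^sub>R (f u * d u)}" "u \<notin> ?N"
      show False
      proof (cases "u \<in> {0..T}")
        case True
        then have "(\<lambda>n. grid_step T n (?c n) u) \<longlonglongrightarrow> f u"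
          using u(2) by (intro cell_values_tendsto[OF T]) auto
        from tendsto_mult_right[OF this, of "d u"] show False using u(1) True by simp
      qed (use u(1) in auto)
    qed
  qed
  then have "- nu_integral T f k = (LINT u:{0..T}|lebesgue. f u * d u)"
    unfolding integral_grid_step_mult by (rule LIMSEQ_unique[OF nu_integral_tendsto[OF T f cont zero]])
  then show ?thesis by simp
qed

end

section \<open>One fixed \<open>t\<close>: the Lebesgue-Stieltjes measure of
  \<open>D(\<cdot>,t)\<close>\<close>

text \<open>At \<open>0\<close> this is free, as the extension is \<open>0\<close> to the left and
  \<open>D 0 = 0\<close>. Elsewhere the left limit only sees values of \<open>D\<close> on
  \<open>[0,x]\<close>.\<close>

lemma constant_extension_left_continuous:
  assumes x: "x \<in> {0..T}" and zero: "D 0 = 0"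
    and cont: "x \<noteq> 0 \<Longrightarrow> continuous (at x within {0..T}) D"
  shows "continuous (at_left x) (constant_extension T D)"
proof (cases "x = 0")
  case True
  have "eventually (\<lambda>y. constant_extension T D y = 0) (at_left 0)"
    by (simp add: eventually_at_filter constant_extension_def)
  then have "(constant_extension T D \<longlongrightarrow> 0) (at_left 0)" by (rule tendsto_eventually)
  then show ?thesis
    using zero x by (simp add: continuous_within True constant_extension_def)
next
  case False
  with x have x0: "0 < x" "x \<le> T" by auto
  have "(D \<longlongrightarrow> D x) (at x within {0..x})"
    using cont[OF False] x0 unfolding continuous_within
    by (elim tendsto_within_subset) auto
  then have "(D \<longlongrightarrow> D x) (at_left x)" using at_within_Icc_at_left[OF x0(1)] by simp
  moreover have "eventually (\<lambda>y. y \<in> {0<..<x}) (at_left x)"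
    by (rule eventually_at_left_real[OF x0(1)])
  then have "eventually (\<lambda>y. D y = constant_extension T D y) (at_left x)"
    by eventually_elim (use x0 in \<open>auto simp: constant_extension_def\<close>)
  ultimately have "(constant_extension T D \<longlongrightarrow> D x) (at_left x)"
    using tendsto_cong by blast
  then show ?thesis using x0 by (simp add: continuous_within constant_extension_def)
qed

lemma right_limit_normalized: "normalized_bv F \<Longrightarrow> right_limit F = F"
  by (rule ext, rule right_limit_eq) (simp add: normalized_bv_def)

text \<open>On each cell the increment of \<open>F\<close> is at most that of its variation
  function, and the cell value is at most \<open>g\<close> in modulus. The bound is the same for all
  \<open>n\<close>, so it can dominate the integration in \<open>t\<close>, with the factor
  \<open>a\<close> standing for \<open>f t\<close>.\<close>

lemma ls_integral_cell_values_le: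
  assumes T: "0 < T" and F: "normalized_bv F" and g: "g \<in> bv_functions T"
  shows "ennreal \<bar>a * ls_integral F {0..T} (grid_step T n (cell_values T g n))\<bar>
    \<le> (\<integral>\<^sup>+s\<in>{0..T}. ennreal \<bar>a * g s\<bar> \<partial>ls_total F)"
proof -
  have bv: "bounded_variation_on F UNIV" using F by (simp add: normalized_bv_def)
  have cont: "continuous (at_right x) F" for x using F by (simp add: normalized_bv_def)
  let ?V = "variation_upto F" and ?c = "cell_values T g n" and ?s = "grid T n"
  have "\<bar>a * ls_integral F {0..T} (grid_step T n ?c)\<bar>
      = \<bar>\<Sum>i<n. a * ?c i * (F (?s (Suc i)) - F (?s i))\<bar>"
    unfolding ls_integral_grid_step[OF bv T] right_limit_normalized[OF F] sum_distrib_left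
    by (simp add: mult.assoc)
  also have "\<dots> \<le> (\<Sum>i<n. \<bar>a * ?c i\<bar> * (?V (?s (Suc i)) - ?V (?s i)))"
  proof (rule order_trans[OF sum_abs], rule sum_mono)
    fix i
    show "\<bar>a * ?c i * (F (?s (Suc i)) - F (?s i))\<bar> \<le> \<bar>a * ?c i\<bar> * (?V (?s (Suc i)) - ?V (?s i))"
      unfolding abs_mult[of "a * ?c i" "F (?s (Suc i)) - F (?s i)"]
      using variation_upto_increment[OF bv grid_mono[OF T, of i "Suc i" n]]
      by (intro mult_left_mono) auto
  qed
  finally have "ennreal \<bar>a * ls_integral F {0..T} (grid_step T n ?c)\<bar>
      \<le> ennreal (\<Sum>i<n. \<bar>a * ?c i\<bar> * (?V (?s (Suc i)) - ?V (?s i)))"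
    by (rule ennreal_leI)
  also have "\<dots> = (\<integral>\<^sup>+x\<in>{0..T}. ennreal (grid_step T n (\<lambda>i. \<bar>a * ?c i\<bar>) x) \<partial>interval_measure ?V)"
    by (intro set_nn_integral_grid_step[symmetric] T variation_upto_mono[OF bv]
        variation_upto_continuous_at_right[OF bv cont]) auto
  also have "\<dots> \<le> (\<integral>\<^sup>+s\<in>{0..T}. ennreal \<bar>a * g s\<bar> \<partial>ls_total F)"
    unfolding ls_total_def right_limit_normalized[OF F]
  proof (rule nn_integral_mono)
    fix x
    have "grid_step T n (\<lambda>i. \<bar>a * ?c i\<bar>) x = \<bar>a * grid_step T n ?c x\<bar>"
      by (rule grid_step_comp[OF T]) simp
    then show "ennreal (grid_step T n (\<lambda>i. \<bar>a * ?c i\<bar>) x) * indicator {0..T} x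
        \<le> ennreal \<bar>a * g x\<bar> * indicator {0..T} x"
      using abs_cell_values_le[OF T g, of x n]
      by (cases "x \<in> {0..T}") (auto simp: abs_mult intro!: ennreal_leI mult_left_mono)
  qed
  finally show ?thesis .
qed

text \<open>The steps can fail to converge to \<open>g\<close> only at \<open>0\<close> and at
  discontinuities of \<open>g\<close>. At all these points the extension of \<open>D\<close> is left
  continuous, at \<open>0\<close> by \<open>D 0 = 0\<close> and elsewhere by \<open>disc\<close>, so
  they carry no mass.\<close>

lemma ls_integral_cell_values_tendsto:
  assumes T: "0 < T" and D: "D 0 = 0" "normalized_bv (constant_extension T D)"
    and g: "g \<in> bv_functions T" and disc: "no_common_discontinuity T g D"
  shows "(\<lambda>n. ls_integral (constant_extension T D) {0..T} (grid_step T n (cell_values T g n)))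
    \<longlonglongrightarrow> ls_integral (constant_extension T D) {0..T} g"
proof -
  obtain C where C: "0 \<le> C" "\<And>x. x \<in> {0..T} \<Longrightarrow> \<bar>g x\<bar> \<le> C" using bv_functions_bounded[OF g] by blast
  have bv: "bounded_variation_on (constant_extension T D) UNIV"
    using D(2) by (simp add: normalized_bv_def)
  let ?N = "insert 0 {x \<in> {0..T}. \<not> continuous (at x within {0..T}) g}"
  show ?thesis
  proof (rule ls_integral_bounded_convergence[OF bv, where N = ?N and C = C])
    have "(\<lambda>x. indicator {0..T} x * g x) = zero_extension T g"
      by (auto simp: zero_extension_def indicator_def)
    then show "(\<lambda>x. indicator {0..T} x * g x) \<in> borel_measurable borel"
      using bv_functions_borel_measurable[OF g] by simp
    show "countable ?N" using bv_functions_countable_discontinuities[OF g] by simp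
    show "\<bar>grid_step T n (cell_values T g n) x\<bar> \<le> C" if "x \<in> {0..T}" for n x
      using abs_cell_values_le[OF T g that, of n] C(2)[OF that] by linarith
    show "(\<lambda>n. grid_step T n (cell_values T g n) x) \<longlonglongrightarrow> g x" if "x \<in> {0..T} - ?N" for x
      using that by (intro cell_values_tendsto T) auto
    show "continuous (at_left x) (right_limit (constant_extension T D))" if "x \<in> ?N" for x
      unfolding right_limit_normalized[OF D(2)]
      using that T disc D(1)
      by (intro constant_extension_left_continuous) (auto simp: no_common_discontinuity_def)
  qed simp
qed

section \<open>The function \<open>psi\<close> and the identity for covariances\<close>

context
  fixes T H :: real and R D :: "real \<Rightarrow> real \<Rightarrow> real" and f g :: "real \<Rightarrow> real"
  assumes T: "0 < T" and H: "0 < H"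
    and R_cont: "continuous_on ({0..T} \<times> {0..T}) (\<lambda>(s, t). R s t)"
    and R_zero: "\<And>s. R s 0 = 0" "\<And>t. R 0 t = 0"
    and R_ac: "\<And>s. s \<in> {0..T} \<Longrightarrow> absolutely_continuous_fun_on 0 T (R s)"
    and pd: "partial_difference T R (fbm_cov H) D"
    and D: "\<And>t. t \<in> {0..T} \<Longrightarrow> D 0 t = 0"
      "\<And>t. t \<in> {0..T} \<Longrightarrow> normalized_bv (constant_extension T (\<lambda>s. D s t))"
    and f: "f \<in> bv_functions T" and g: "g \<in> bv_functions T"
begin

lemma fbm_cov_continuous: "continuous_on ({0..T} \<times> {0..T}) (\<lambda>(s, t). fbm_cov H s t)"
proof -
  let ?S = "{0..T} \<times> {0..T}"
  have powr: "continuous_on ?S (\<lambda>p. h p powr (2 * H))"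
    if "continuous_on ?S h" "\<And>p. p \<in> ?S \<Longrightarrow> 0 \<le> h p" for h :: "real \<times> real \<Rightarrow> real"
    using that H by (intro continuous_on_powr' continuous_on_const) auto
  have "continuous_on ?S (\<lambda>p. fst p powr (2 * H))" "continuous_on ?S (\<lambda>p. snd p powr (2 * H))"
    "continuous_on ?S (\<lambda>p. \<bar>snd p - fst p\<bar> powr (2 * H))"
    by (rule powr; auto intro!: continuous_intros)+
  then show ?thesis
    unfolding fbm_cov_def case_prod_beta
    by (intro continuous_on_divide continuous_on_diff continuous_on_add continuous_on_const) auto
qed

lemma fbm_cov_zero: "s \<in> {0..T} \<Longrightarrow> fbm_cov H s 0 = 0" "t \<in> {0..T} \<Longrightarrow> fbm_cov H 0 t = 0"
  using H by (auto simp: fbm_cov_def)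

lemma kernel_difference_continuous:
  "continuous_on ({0..T} \<times> {0..T}) (\<lambda>(s, t). R s t - fbm_cov H s t)"
  using continuous_on_diff[OF R_cont fbm_cov_continuous] by (simp add: case_prod_beta)

lemma
  assumes "s \<in> {0..T}"
  shows D_absolutely_integrable: "(\<lambda>t. D s t) absolutely_integrable_on {0..T}"
    and D_has_integral: "0 \<le> a \<Longrightarrow> a \<le> b \<Longrightarrow> b \<le> T \<Longrightarrow>
      (D s has_integral (R s b - fbm_cov H s b) - (R s a - fbm_cov H s a)) {a..b}"
proof -
  have "AE t in lebesgue. t \<in> {0..T} \<longrightarrow>
     (\<exists>r r'. (R s has_real_derivative r) (at t within {0..T})
           \<and> (fbm_cov H s has_real_derivative r') (at t within {0..T}) \<and> D s t = r - r')"
    using pd assms unfolding partial_difference_def by blast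
  note * = derivative_difference_integral[OF T H _ R_ac[OF assms] this]
  show "(\<lambda>t. D s t) absolutely_integrable_on {0..T}" using *(1) assms by simp
  show "0 \<le> a \<Longrightarrow> a \<le> b \<Longrightarrow> b \<le> T \<Longrightarrow>
      (D s has_integral (R s b - fbm_cov H s b) - (R s a - fbm_cov H s a)) {a..b}"
    using *(2) assms by simp
qed

definition psi :: "real \<Rightarrow> real" where
  "psi s = (LINT u:{0..T}|lebesgue. f u * D s u)"

lemma nu_integral_kernel_difference:
  assumes "s \<in> {0..T}"
  shows "nu_integral T f (\<lambda>t. R s t - fbm_cov H s t) = - psi s"
  unfolding psi_def
  by (rule nu_integral_eq_integral[OF T D_absolutely_integrable[OF assms] D_has_integral[OF assms] f
        continuous_sections(1)[OF kernel_difference_continuous assms]])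
    (use assms R_zero fbm_cov_zero in auto)

text \<open>Since \<open>D\<close> is only right continuous in \<open>s\<close>, continuity is not
  visible in the definition of \<open>psi\<close>. It is inherited from the continuous kernel
  through \<open>nu_integral_kernel_difference\<close>.\<close>

lemma psi_continuous: "continuous_on {0..T} psi"
proof -
  have "continuous_on {0..T} (\<lambda>s. - nu_integral T f (\<lambda>t. R s t - fbm_cov H s t))"
    by (intro continuous_intros continuous_on_nu_integral[OF f] kernel_difference_continuous)
  then show ?thesis
    by (rule continuous_on_eq) (simp add: nu_integral_kernel_difference)
qed

lemma psi_zero: "psi 0 = 0"
  unfolding psi_def set_lebesgue_integral_def
  by (rule integral_eq_zero_AE) (auto simp: indicator_def D(1))

text \<open>Linearity is used for the outer and then for the inner integral; the required zeros at
  \<open>0\<close> come from both covariances vanishing on the axes.\<close>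

lemma nu_integral_difference:
  "nu_integral T g (\<lambda>s. nu_integral T f (R s)) - nu_integral T g (\<lambda>s. nu_integral T f (fbm_cov H s))
    = nu_integral T g (\<lambda>s. - psi s)"
proof -
  have zero: "nu_integral T f (\<lambda>t. 0) = 0"
    by (simp add: nu_integral_def ls_integral_def set_lebesgue_integral_def)
  have fbm0: "nu_integral T f (fbm_cov H 0) = 0"
    using nu_integral_cong[of T "fbm_cov H 0" "\<lambda>t. 0" f] fbm_cov_zero zero by simp
  have R0: "nu_integral T f (R 0) = 0" using zero R_zero by (simp add: R_zero(2)[abs_def])
  have "nu_integral T g (\<lambda>s. nu_integral T f (R s)) - nu_integral T g (\<lambda>s. nu_integral T f (fbm_cov H s))
      = nu_integral T g (\<lambda>s. nu_integral T f (R s) - nu_integral T f (fbm_cov H s))"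
    by (intro nu_integral_diff[symmetric] T g continuous_on_nu_integral[OF f] R_cont
        fbm_cov_continuous R0 fbm0)
  also have "\<dots> = nu_integral T g (\<lambda>s. - psi s)"
  proof (rule nu_integral_cong)
    fix s assume s: "s \<in> {0..T}"
    have "nu_integral T f (R s) - nu_integral T f (fbm_cov H s) = nu_integral T f (\<lambda>t. R s t - fbm_cov H s t)"
      by (intro nu_integral_diff[symmetric] T f continuous_sections(1)[OF R_cont s]
          continuous_sections(1)[OF fbm_cov_continuous s] R_zero fbm_cov_zero s)
    then show "nu_integral T f (R s) - nu_integral T f (fbm_cov H s) = - psi s"
      using nu_integral_kernel_difference[OF s] by simp
  qed
  finally show ?thesis .
qed

text \<open>For a grid step function the inner integral is a finite combination of the values
  \<open>D (grid T n i) u\<close>, so the integration in \<open>u\<close> is carried out term by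
  term and produces values of \<open>psi\<close>. This replaces Fubini's theorem and provides the
  measurability in \<open>u\<close> needed in the limit.\<close>

lemma integral_ls_integral_cell_values:
  "(LINT u:{0..T}|lebesgue. f u * ls_integral (constant_extension T (\<lambda>s. D s u)) {0..T} (grid_step T n c))
    = (\<Sum>i<n. c i * (psi (grid T n (Suc i)) - psi (grid T n i)))"
  and set_integrable_ls_integral_cell_values:
  "set_integrable lebesgue {0..T}
    (\<lambda>u. f u * ls_integral (constant_extension T (\<lambda>s. D s u)) {0..T} (grid_step T n c))"
proof -
  let ?s = "grid T n"
  let ?F = "\<lambda>u. \<Sum>i<n. c i * (f u * D (?s (Suc i)) u - f u * D (?s i) u)"
  have eq: "f u * ls_integral (constant_extension T (\<lambda>s. D s u)) {0..T} (grid_step T n c) = ?F u"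
    if u: "u \<in> {0..T}" for u
  proof -
    have bv: "bounded_variation_on (constant_extension T (\<lambda>s. D s u)) UNIV"
      using D(2)[OF u] by (simp add: normalized_bv_def)
    have "constant_extension T (\<lambda>s. D s u) (?s i) = D (?s i) u" if "i \<le> n" for i
      using grid_mem[OF T that] by (simp add: constant_extension_def)
    then show ?thesis
      unfolding ls_integral_grid_step[OF bv T] right_limit_normalized[OF D(2)[OF u]] sum_distrib_left
      by (intro sum.cong) (auto simp: algebra_simps)
  qed
  have int: "set_integrable lebesgue {0..T} (\<lambda>u. f u * D (?s i) u)" if "i \<le> n" for i
    using grid_mem[OF T that]
    by (intro set_integrable_bv_mult[OF T D_absolutely_integrable D_has_integral f])
  have int': "set_integrable lebesgue {0..T} (\<lambda>u. c i * (f u * D (?s (Suc i)) u - f u * D (?s i) u))"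
    if "i < n" for i
    using int[of i] int[of "Suc i"] that by (intro set_integrable_mult_right set_integral_diff(1)) auto
  have "(LINT u:{0..T}|lebesgue. ?F u)
      = (\<Sum>i<n. LINT u:{0..T}|lebesgue. c i * (f u * D (?s (Suc i)) u - f u * D (?s i) u))"
    using int' unfolding set_lebesgue_integral_def set_integrable_def scaleR_sum_right
    by (intro Bochner_Integration.integral_sum) auto
  also have "\<dots> = (\<Sum>i<n. c i * (psi (?s (Suc i)) - psi (?s i)))"
    using int by (intro sum.cong) (auto simp: psi_def set_integral_diff(2))
  finally show "(LINT u:{0..T}|lebesgue. f u * ls_integral (constant_extension T (\<lambda>s. D s u)) {0..T} (grid_step T n c))
    = (\<Sum>i<n. c i * (psi (?s (Suc i)) - psi (?s i)))"
    using eq by (subst set_lebesgue_integral_cong[of _ _ _ ?F]) auto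
  have "set_integrable lebesgue {0..T} ?F"
    using int' unfolding set_integrable_def scaleR_sum_right
    by (intro Bochner_Integration.integrable_sum) auto
  then show "set_integrable lebesgue {0..T}
    (\<lambda>u. f u * ls_integral (constant_extension T (\<lambda>s. D s u)) {0..T} (grid_step T n c))"
    using eq by (subst set_integrable_cong[OF refl refl]) auto
qed

text \<open>The same Riemann sums have two limits: by dominated convergence in \<open>u\<close> they
  tend to the double integral, and by integration by parts to the integral of \<open>- psi\<close>
  against the measure of \<open>g\<close>.\<close>

lemma nu_integral_difference_eq_dt_mu_integral:
  assumes dt: "dt_mu_integrable T D f g"
    and disc: "\<And>t. t \<in> {0..T} \<Longrightarrow> no_common_discontinuity T g (\<lambda>s. D s t)"
  shows "nu_integral T g (\<lambda>s. nu_integral T f (R s)) - nu_integral T g (\<lambda>s. nu_integral T f (fbm_cov H s))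
    = dt_mu_integral T D f g"
proof -
  let ?E = "\<lambda>u. constant_extension T (\<lambda>s. D s u)"
  let ?F = "\<lambda>n u. indicator {0..T} u *\<^sub>R (f u * ls_integral (?E u) {0..T} (grid_step T n (cell_values T g n)))"
  \<comment> \<open>This bounds the integrands for all \<open>n\<close> and has a finite integral by
    \<open>dt\<close>. Its measurability in \<open>u\<close> is not established, hence the version
    of dominated convergence with a lower integral.\<close>
  let ?h = "\<lambda>u. (\<integral>\<^sup>+s\<in>{0..T}. ennreal \<bar>f u * g s\<bar> \<partial>ls_total (?E u)) * indicator {0..T} u"
  have "(\<lambda>n. LINT u|lebesgue. ?F n u)
      \<longlonglongrightarrow> (LINT u|lebesgue. indicator {0..T} u *\<^sub>R (f u * ls_integral (?E u) {0..T} g))"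
  proof (rule dominated_by_lower_integral[where h = ?h])
    show "?F n \<in> borel_measurable lebesgue" for n
      using set_integrable_ls_integral_cell_values[of n "cell_values T g n"]
      unfolding set_integrable_def by (rule borel_measurable_integrable)
    show "(\<integral>\<^sup>+u. ?h u \<partial>lebesgue) < \<infinity>" using dt by (simp add: dt_mu_integrable_def)
    fix u
    show "ennreal \<bar>?F n u\<bar> \<le> ?h u" for n
      using ls_integral_cell_values_le[OF T D(2) g, of u "f u" n] by (cases "u \<in> {0..T}") auto
    show "(\<lambda>n. ?F n u) \<longlonglongrightarrow> indicator {0..T} u *\<^sub>R (f u * ls_integral (?E u) {0..T} g)"
      using ls_integral_cell_values_tendsto[OF T D g disc, of u]
      by (cases "u \<in> {0..T}") (auto intro: tendsto_mult_left)
  qed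
  then have lim: "(\<lambda>n. \<Sum>i<n. cell_values T g n i * (psi (grid T n (Suc i)) - psi (grid T n i)))
      \<longlonglongrightarrow> dt_mu_integral T D f g"
    using integral_ls_integral_cell_values
    unfolding dt_mu_integral_def set_lebesgue_integral_def by simp
  \<comment> \<open>The minus sign produced by integration by parts cancels the one in front of
    \<open>psi\<close>.\<close>
  have "(\<lambda>n. \<Sum>i<n. cell_values T g n i * (- psi (grid T n (Suc i)) - - psi (grid T n i)))
      \<longlonglongrightarrow> - nu_integral T g (\<lambda>s. - psi s)"
    by (rule nu_integral_tendsto[OF T g]) (auto intro!: continuous_intros psi_continuous simp: psi_zero)
  from tendsto_minus[OF this]
  have "(\<lambda>n. \<Sum>i<n. cell_values T g n i * (psi (grid T n (Suc i)) - psi (grid T n i)))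
      \<longlonglongrightarrow> nu_integral T g (\<lambda>s. - psi s)"
    by (simp add: sum_negf[symmetric] right_diff_distrib)
  from LIMSEQ_unique[OF this lim] show ?thesis using nu_integral_difference by simp
qed

end

section \<open>From covariances to inner products in the Hilbert spaces\<close>

lemma continuous_imp_no_common_discontinuity:
  "continuous_on {0..T} g \<Longrightarrow> no_common_discontinuity T g h"
  by (simp add: no_common_discontinuity_def continuous_on_eq_continuous_within)

theorem theorem2p1:
  fixes M :: "'a measure" and N :: "'b measure"
    and G :: "real \<Rightarrow> 'a \<Rightarrow> real" and B :: "real \<Rightarrow> 'b \<Rightarrow> real"
    and D :: "real \<Rightarrow> real \<Rightarrow> real"
    and \<iota> :: "(real \<Rightarrow> real) \<Rightarrow> 'h::{real_inner, complete_space}"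
    and \<iota>\<^sub>1 :: "(real \<Rightarrow> real) \<Rightarrow> 'k::{real_inner, complete_space}"
    and T H :: real and f g :: "real \<Rightarrow> real"
  assumes "0 < T" and "0 < H" and "H < 1"
    and "fractional_gaussian_process M T H G D"
    and "fractional_brownian_motion N T H B"
    and "associated_hilbert_space M T G \<iota>"
    and "associated_hilbert_space N T B \<iota>\<^sub>1"
    and "f \<in> bv_functions T" and "g \<in> bv_functions T"
    and "dt_mu_integrable T D f g"
  shows "((\<forall>t\<in>{0..T}. no_common_discontinuity T g (\<lambda>s. D s t)) \<longrightarrow>
            inner (\<iota> f) (\<iota> g) - inner (\<iota>\<^sub>1 f) (\<iota>\<^sub>1 g) = dt_mu_integral T D f g)
       \<and> (continuous_on {0..T} g \<longrightarrow>
            inner (\<iota> f) (\<iota> g) - inner (\<iota>\<^sub>1 f) (\<iota>\<^sub>1 g) = dt_mu_integral T D f g)"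
proof -
  have G0: "AE \<omega> in M. G 0 \<omega> = 0"
    and pd: "partial_difference T (covariance_fun M G) (fbm_cov H) D"
    and cont: "continuous_on ({0..T} \<times> {0..T}) (\<lambda>(s, t). covariance_fun M G s t)"
    and ac: "\<And>s. s \<in> {0..T} \<Longrightarrow> absolutely_continuous_fun_on 0 T (covariance_fun M G s)"
    and D: "\<And>t. t \<in> {0..T} \<Longrightarrow> D 0 t = 0"
      "\<And>t. t \<in> {0..T} \<Longrightarrow> normalized_bv (constant_extension T (\<lambda>s. D s t))"
    using assms(4) unfolding fractional_gaussian_process_def by auto
  \<comment> \<open>\<open>G 0\<close> vanishes almost surely, hence so does every product that
    contains it.\<close>
  have zero: "covariance_fun M G s 0 = 0" "covariance_fun M G 0 s = 0" for s
    unfolding covariance_fun_def using G0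
    by (auto intro!: integral_eq_zero_AE elim!: eventually_mono)
  have "inner (\<iota> f) (\<iota> g) = nu_integral T g (\<lambda>s. nu_integral T f (covariance_fun M G s))"
    using assms(6,8,9) unfolding associated_hilbert_space_def by blast
  moreover have "inner (\<iota>\<^sub>1 f) (\<iota>\<^sub>1 g) = nu_integral T g (\<lambda>s. nu_integral T f (covariance_fun N B s))"
    using assms(7-9) unfolding associated_hilbert_space_def by blast
  \<comment> \<open>The covariance of \<open>B\<close> is known on the square \<open>[0,T]\<close>
    times \<open>[0,T]\<close> only, so the replacement is made inside both integrals, under the
    restriction to \<open>[0,T]\<close>.\<close>
  moreover have "nu_integral T g (\<lambda>s. nu_integral T f (covariance_fun N B s))
      = nu_integral T g (\<lambda>s. nu_integral T f (fbm_cov H s))"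
    using assms(5) unfolding fractional_brownian_motion_def by (intro nu_integral_cong) auto
  moreover note nu_integral_difference_eq_dt_mu_integral[OF assms(1,2) cont zero ac pd D assms(8-10)]
  ultimately have "inner (\<iota> f) (\<iota> g) - inner (\<iota>\<^sub>1 f) (\<iota>\<^sub>1 g) = dt_mu_integral T D f g"
    if "\<And>t. t \<in> {0..T} \<Longrightarrow> no_common_discontinuity T g (\<lambda>s. D s t)"
    using that by simp
  then show ?thesis using continuous_imp_no_common_discontinuity by blast
qed

end
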